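(* For all $1\le k,\ell\le6$ and every $z_0$ in the interior of $V_{k,\ell}$, the set $$V^*_{k,\ell}=\left\{-\frac{q_n(z)}{q_{n-1}(z)}: n\ge1,\ z\in U,\ T^n(z)=z_0\right\}^{cl}$$ (closure in $\mathbb C$) is equal to the closure in $\mathbb C$ of $V^*_{0,k,\ell}$.
   Context: Let $\zeta=\frac{1+\sqrt{-3}}2$, $\eta=\frac{3+\sqrt{-3}}2$, $\mathfrak o(\sqrt{-3})=\mathbb Z+\mathbb Z\zeta$, $\mathcal J=\eta\cdot\mathfrak o(\sqrt{-3})$. $U$ is the fundamental domain of $\mathbb C/\mathcal J$ consisting of the open regular hexagon with vertices $\zeta^k$ ($0\le k\le 5$), together with the three open sides $\{t\zeta+(1-t)(-\overline\zeta):0<t<1\}$, $\{t(-\zeta)+(1-t)(-1):0<t<1\}$, $\{t+(1-t)\overline\zeta:0<t<1\}$ and the two vertices $-\zeta,\overline\zeta$. For $z\in\mathbb C$, $[z]$ is the unique $a\in\mathcal J$ with $z\in a+U$. The map $T:U\to U$ is $T(z)=\frac1z-[\frac1z]$ for $z\ne0$, $T(0)=0$; $b_n(z)=[1/T^{n-1}(z)]$ when $T^{n-1}(z)\ne0$. The denominators are $q_{-1}(z)=0$, $q_0(z)=1$, $q_{n}(z)=b_{n}(z)q_{n-1}(z)+q_{n-2}(z)$ for $n\ge1$. Write $z=x+yi$, $r=\frac{\sqrt3}3$. Put $V_{1,1}=\{z\in U:|z-\frac13\overline\eta|<r,\ |z-\frac13\sqrt{-3}|<r\}$, $V_{2,1}=\{z\in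 U:|z-\frac23\eta|>r,\ |z-\frac13\sqrt{-3}|>r,\ x>0,\ y>0\}$, $V_{3,1}=\{z\in U:|z-\frac23\eta|>r,\ |z-\frac13\overline\eta|>r,\ y>0,\ y<\sqrt3x\}$, $V_{4,1}=\{z\in U:|z-\frac13\overline\eta|<r,\ |z-\frac23\eta|<r\}$, $V_{5,1}=\{z\in U:|z-\frac23\eta|<r,\ |z-\frac13\sqrt{-3}|<r\}$, $V_{6,1}=\{z\in U:|z-\frac13\overline\eta|>r,\ |z-\frac13\sqrt{-3}|>r,\ x>0,\ y>0\}$, and $V_{k,\ell}=\zeta^{\ell-1}V_{k,1}$ for $1\le k,\ell\le6$. Put $V^*_{0,1,1}=\{|z|>1,\ |z-\frac{\sqrt{-3}}2|>\frac12,\ |z-\frac\eta2|>\frac12,\ |z-\frac{\overline\eta}2|>\frac12\}$, $V^*_{0,2,1}=\{|z|>1,\ |z-\frac\eta2|>\frac12,\ |z-\frac{\overline\eta}2|>\frac12\}$, $V^*_{0,3,1}=\{|z|>1,\ |z-\frac{\sqrt{-3}}2|>\frac12,\ |z-\frac\eta2|>\frac12\}$, $V^*_{0,4,1}=\{|z|>1,\ |z-\eta|>1,\ |z-\frac{\overline\eta}2|>\frac12\}$, $V^*_{0,5,1}=\{|z|>1,\ |z-\eta|>1,\ |z-\frac{\sqrt{-3}}2|>\frac12\}$, $V^*_{0,6,1}=\{|z|>1,\ |z-\eta|>1\}$ (all subsets of $\mathbb C$), and $V^*_{0,k,\ell}=\zeta^{\ell-1}V^*_{0,k,1}$. *)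

theory Defs
  imports "HOL-Analysis.Analysis"
begin

definition zeta6 :: complex where
  "zeta6 = (1 + \<i> * sqrt 3) / 2"

definition eta6 :: complex where
  "eta6 = (3 + \<i> * sqrt 3) / 2"

definition eisenstein_ring :: "complex set" where
  "eisenstein_ring = {of_int m + of_int n * zeta6 | m n. True}"

definition ideal_J :: "complex set" where
  "ideal_J = {eta6 * w | w. w \<in> eisenstein_ring}"

definition open_hexagon :: "complex set" where
  "open_hexagon = interior (convex hull {zeta6 ^ k | k. k \<le> 5})"

definition dom_U :: "complex set" where
  "dom_U = open_hexagon
     \<union> open_segment zeta6 (- cnj zeta6)
     \<union> open_segment (- zeta6) (- 1)
     \<union> open_segment 1 (cnj zeta6)
     \<union> {- zeta6, cnj zeta6}"

definition J_part :: "complex \<Rightarrow> complex" where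
  "J_part z = (THE a. a \<in> ideal_J \<and> z \<in> (\<lambda>u. a + u) ` dom_U)"

definition cf_map :: "complex \<Rightarrow> complex" where
  "cf_map z = (if z = 0 then 0 else 1 / z - J_part (1 / z))"

text \<open>The digit of index \<open>n\<close> is meaningful only for \<open>n \<ge> 1\<close> and
  \<open>(cf_map ^^ (n - 1)) z \<noteq> 0\<close>. If \<open>(cf_map ^^ n) z \<noteq> 0\<close>, all digits of index
  \<open>1, \<dots>, n\<close> are meaningful, since \<open>cf_map\<close> fixes \<open>0\<close>.\<close>

definition cf_digit :: "nat \<Rightarrow> complex \<Rightarrow> complex" where
  "cf_digit n z = J_part (1 / (cf_map ^^ (n - 1)) z)"

text \<open>The second equation is the general recursion at index \<open>1\<close> with the
  convention that the denominator of index \<open>-1\<close> is \<open>0\<close>.\<close>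

fun cf_denom :: "nat \<Rightarrow> complex \<Rightarrow> complex" where
  "cf_denom 0 z = 1"
| "cf_denom (Suc 0) z = cf_digit 1 z * cf_denom 0 z + 0"
| "cf_denom (Suc (Suc n)) z =
     cf_digit (Suc (Suc n)) z * cf_denom (Suc n) z + cf_denom n z"

text \<open>In the following definitions only the indices \<open>1, \<dots>, 6\<close> are relevant;
  \<open>\<i> * sqrt 3\<close> is the square root of \<open>-3\<close>.\<close>

definition cell_base :: "nat \<Rightarrow> complex set" where
  "cell_base k =
    (let r = sqrt 3 / 3 in
     if k = 1 then
       {z \<in> dom_U. cmod (z - cnj eta6 / 3) < r \<and> cmod (z - \<i> * sqrt 3 / 3) < r}
     else if k = 2 then
       {z \<in> dom_U. cmod (z - 2 / 3 * eta6) > r \<and> cmod (z - \<i> * sqrt 3 / 3) > r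
          \<and> Re z > 0 \<and> Im z > 0}
     else if k = 3 then
       {z \<in> dom_U. cmod (z - 2 / 3 * eta6) > r \<and> cmod (z - cnj eta6 / 3) > r
          \<and> Im z > 0 \<and> Im z < sqrt 3 * Re z}
     else if k = 4 then
       {z \<in> dom_U. cmod (z - cnj eta6 / 3) < r \<and> cmod (z - 2 / 3 * eta6) < r}
     else if k = 5 then
       {z \<in> dom_U. cmod (z - 2 / 3 * eta6) < r \<and> cmod (z - \<i> * sqrt 3 / 3) < r}
     else if k = 6 then
       {z \<in> dom_U. cmod (z - cnj eta6 / 3) > r \<and> cmod (z - \<i> * sqrt 3 / 3) > r
          \<and> Re z > 0 \<and> Im z > 0}
     else {})"

definition cell :: "nat \<Rightarrow> nat \<Rightarrow> complex set" where
  "cell k l = (\<lambda>z. zeta6 ^ (l - 1) * z) ` cell_base k"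

definition dual_cell_base :: "nat \<Rightarrow> complex set" where
  "dual_cell_base k =
    (if k = 1 then
       {z. cmod z > 1 \<and> cmod (z - \<i> * sqrt 3 / 2) > 1 / 2
          \<and> cmod (z - eta6 / 2) > 1 / 2 \<and> cmod (z - cnj eta6 / 2) > 1 / 2}
     else if k = 2 then
       {z. cmod z > 1 \<and> cmod (z - eta6 / 2) > 1 / 2 \<and> cmod (z - cnj eta6 / 2) > 1 / 2}
     else if k = 3 then
       {z. cmod z > 1 \<and> cmod (z - \<i> * sqrt 3 / 2) > 1 / 2 \<and> cmod (z - eta6 / 2) > 1 / 2}
     else if k = 4 then
       {z. cmod z > 1 \<and> cmod (z - eta6) > 1 \<and> cmod (z - cnj eta6 / 2) > 1 / 2}
     else if k = 5 then
       {z. cmod z > 1 \<and> cmod (z - eta6) > 1 \<and> cmod (z - \<i> * sqrt 3 / 2) > 1 / 2}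
     else if k = 6 then
       {z. cmod z > 1 \<and> cmod (z - eta6) > 1}
     else {})"

definition dual_cell :: "nat \<Rightarrow> nat \<Rightarrow> complex set" where
  "dual_cell k l = (\<lambda>z. zeta6 ^ (l - 1) * z) ` dual_cell_base k"

end

theory Submission
  imports Defs
begin

text \<open>
  The proof uses the natural extension \<open>(z, w) \<mapsto> (1/z - b, 1/w - b)\<close>, where \<open>b\<close> is the digit of
  \<open>z\<close>: the numbers \<open>w\<^sub>n = - q\<^sub>n / q\<^sub>n\<^sub>-\<^sub>1\<close> satisfy \<open>w\<^sub>n\<^sub>+\<^sub>1 = 1/w\<^sub>n - b\<^sub>n\<^sub>+\<^sub>1\<close>, starting
  from \<open>w\<^sub>0 = \<infinity>\<close>. Let \<open>e\<close> run through the six shortest vectors of the lattice. The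
  dual cell of a generic point \<open>z\<close> consists of the \<open>w\<close> with \<open>|w| > 1\<close> such that
  \<open>|w - e/2| > 1/2\<close> whenever \<open>|z - e/3| < r\<close>, and \<open>|w - e| > 1\<close> whenever \<open>|z - 2e/3| < r\<close>.
  In this form one checks, for one lattice vector at a time, that the natural extension maps dual
  cells into dual cells; this gives one inclusion.

  Conversely, every \<open>w\<close> in a closed dual cell that is not a vertex of the hexagonal tiling has
  a preimage under the natural extension over a generic point. For \<open>w = p/q\<close> with Eisenstein
  integers \<open>p\<close>, \<open>q\<close> of which exactly one lies in the prime ideal generated by \<open>\<surd>-3\<close>, no
  preimage is ever a vertex, and \<open>|q|\<close> decreases until \<open>\<infinity>\<close> is reached. So \<open>w\<close> is
  one of the numbers \<open>w\<^sub>n\<close>, and such \<open>p/q\<close> are dense.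
\<close>

section \<open>Eisenstein coordinates\<close>

text \<open>In these coordinates all circles and lines of the statement have rational equations.\<close>

definition eis :: "real \<Rightarrow> real \<Rightarrow> complex" where
  "eis a b = of_real a + of_real b * zeta6"

lemma Re_eis [simp]: "Re (eis a b) = a + b / 2"
  by (simp add: eis_def zeta6_def)

lemma Im_eis [simp]: "Im (eis a b) = sqrt 3 * b / 2"
  by (simp add: eis_def zeta6_def)

lemma eis_eq_iff [simp]: "eis a b = eis c d \<longleftrightarrow> a = c \<and> b = d"
  by (auto simp: complex_eq_iff)

lemma eis_eq_0_iff [simp]: "eis a b = 0 \<longleftrightarrow> a = 0 \<and> b = 0"
  by (auto simp: complex_eq_iff)

lemma eis_add [simp]: "eis a b + eis c d = eis (a + c) (b + d)"
  by (simp add: eis_def algebra_simps)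

lemma eis_diff [simp]: "eis a b - eis c d = eis (a - c) (b - d)"
  by (simp add: eis_def algebra_simps)

lemma eis_uminus [simp]: "- eis a b = eis (- a) (- b)"
  by (simp add: eis_def algebra_simps)

lemma zeta6_square: "zeta6 * zeta6 = zeta6 - 1"
  by (simp add: complex_eq_iff zeta6_def field_simps)

lemma eis_mult [simp]: "eis a b * eis c d = eis (a * c - b * d) (a * d + b * c + b * d)"
proof -
  have "eis a b * eis c d = of_real (a * c) + of_real (a * d + b * c) * zeta6 + of_real (b * d) * (zeta6 * zeta6)"
    by (simp add: eis_def algebra_simps)
  then show ?thesis
    by (simp add: zeta6_square) (simp add: eis_def algebra_simps)
qed

lemma inner_eis: "eis a b \<bullet> eis c d = a * c + b * d + (a * d + b * c) / 2"
  by (simp add: inner_complex_def field_simps)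

lemma cnj_eis [simp]: "cnj (eis a b) = eis (a + b) (- b)"
  by (simp add: complex_eq_iff)

lemma zeta6_eis: "zeta6 = eis 0 1" and eta6_eis: "eta6 = eis 1 1" and one_eis: "1 = eis 1 0"
  by (simp_all add: complex_eq_iff zeta6_def eta6_def)

lemma ex_eis: obtains a b where "z = eis a b"
proof
  show "z = eis (Re z - Im z / sqrt 3) (2 * Im z / sqrt 3)"
    by (simp add: complex_eq_iff)
qed

lemma inner_self_cmod: "x \<bullet> x = (cmod x)\<^sup>2" for x :: complex
  by (simp add: power2_norm_eq_inner)

lemma cmod_less_iff: "0 \<le> c \<Longrightarrow> cmod x < c \<longleftrightarrow> x \<bullet> x < c\<^sup>2"
  by (metis inner_self_cmod norm_ge_zero power2_less_imp_less power_strict_mono zero_less_numeral)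

lemma less_cmod_iff: "0 \<le> c \<Longrightarrow> c < cmod x \<longleftrightarrow> c\<^sup>2 < x \<bullet> x"
  by (metis inner_self_cmod norm_ge_zero power2_less_imp_less power_strict_mono zero_less_numeral)

lemma le_cmod_iff: "0 \<le> c \<Longrightarrow> c \<le> cmod x \<longleftrightarrow> c\<^sup>2 \<le> x \<bullet> x"
  using cmod_less_iff[of c x] by linarith

text \<open>The six numbers \<open>zeta6 ^ j * eta6\<close>, the shortest nonzero vectors of \<open>ideal_J\<close>.\<close>

definition short_vecs :: "complex set" where
  "short_vecs = {eis 1 1, eis (- 1) 2, eis (- 2) 1, eis (- 1) (- 1), eis 1 (- 2), eis 2 (- 1)}"

lemma short_inner_self: "e \<in> short_vecs \<Longrightarrow> e \<bullet> e = 3"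
  by (auto simp: short_vecs_def inner_eis)

lemma short_cmod: "e \<in> short_vecs \<Longrightarrow> cmod e = sqrt 3"
  by (simp add: norm_eq_sqrt_inner short_inner_self)

lemma short_uminus: "e \<in> short_vecs \<Longrightarrow> - e \<in> short_vecs"
  by (auto simp: short_vecs_def)

lemma short_uminus_iff [simp]: "- e \<in> short_vecs \<longleftrightarrow> e \<in> short_vecs"
  using short_uminus[of e] short_uminus[of "- e"] by auto

lemma short_cnj: "e \<in> short_vecs \<Longrightarrow> cnj e \<in> short_vecs"
  by (auto simp: short_vecs_def)

lemma short_zeta6: "e \<in> short_vecs \<Longrightarrow> zeta6 * e \<in> short_vecs"
  by (auto simp: short_vecs_def zeta6_eis)

lemma short_cnj_zeta6: "e \<in> short_vecs \<Longrightarrow> cnj zeta6 * e \<in> short_vecs"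
  by (auto simp: short_vecs_def zeta6_eis)

text \<open>The six vectors lie on a circle of radius \<open>sqrt 3\<close> at multiples of 60
  degrees. At 60 degrees the difference, at 120 degrees the sum, is again one of the six.\<close>

lemma short_inner_cases:
  assumes "e \<in> short_vecs" "f \<in> short_vecs"
  obtains "e = f" | "e = - f" | "e \<bullet> f = 3 / 2" "e - f \<in> short_vecs" | "e \<bullet> f = - (3 / 2)" "e + f \<in> short_vecs"
proof -
  have "e = f \<or> e = - f \<or> (e \<bullet> f = 3 / 2 \<and> e - f \<in> short_vecs) \<or> (e \<bullet> f = - (3 / 2) \<and> e + f \<in> short_vecs)"
    using assms unfolding short_vecs_def by (elim insertE emptyE) (simp_all add: inner_eis)
  then show ?thesis using that by blast
qed

lemma abs_inner_short_le:
  assumes "e \<in> short_vecs"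
  shows "\<bar>x \<bullet> e\<bar> \<le> sqrt 3 * cmod x"
  using Cauchy_Schwarz_ineq2[of x e] assms by (simp add: short_cmod mult.commute)

section \<open>The ideal as a lattice\<close>

lemma mem_ideal_J_iff:
  "z \<in> ideal_J \<longleftrightarrow> (\<exists>m n. z = eis (of_int m) (of_int n) \<and> (3::int) dvd m - n)"
proof
  assume "z \<in> ideal_J"
  then obtain m n where "z = eta6 * (of_int m + of_int n * zeta6)"
    by (auto simp: ideal_J_def eisenstein_ring_def)
  then have "z = eis 1 1 * eis (of_int m) (of_int n)"
    by (simp only: eta6_eis) (simp only: eis_def of_real_of_int_eq)
  then have "z = eis (of_int (m - n)) (of_int (m + 2 * n))"
    by simp
  moreover have "3 dvd (m - n) - (m + 2 * n)"
    by presburger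
  ultimately show "\<exists>m n. z = eis (of_int m) (of_int n) \<and> (3::int) dvd m - n"
    by blast
next
  assume "\<exists>m n. z = eis (of_int m) (of_int n) \<and> (3::int) dvd m - n"
  then obtain m n k where "z = eis (of_int m) (of_int n)" "m - n = 3 * k"
    by (auto elim: dvdE)
  \<comment> \<open>Solving \<open>p - q = m\<close>, \<open>p + 2 * q = n\<close> for the
    coordinates of \<open>z / eta6\<close> gives \<open>p = m - k\<close>,
    \<open>q = - k\<close>.\<close>
  then have "z = eis 1 1 * eis (of_int (m - k)) (of_int (- k))"
    by (simp flip: of_int_diff of_int_add)
  then have "z = eta6 * (of_int (m - k) + of_int (- k) * zeta6)"
    by (simp only: eta6_eis) (simp only: eis_def of_real_of_int_eq)
  then show "z \<in> ideal_J"
    unfolding ideal_J_def eisenstein_ring_def by blast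
qed

lemma mem_eisenstein_ring_iff:
  "z \<in> eisenstein_ring \<longleftrightarrow> (\<exists>m n. z = eis (of_int m) (of_int n))"
  by (simp add: eisenstein_ring_def eis_def)

lemma ideal_J_0: "0 \<in> ideal_J"
  unfolding mem_ideal_J_iff by (rule exI[of _ 0], rule exI[of _ 0]) (simp add: complex_eq_iff)

lemma ideal_J_add: "a \<in> ideal_J \<Longrightarrow> b \<in> ideal_J \<Longrightarrow> a + b \<in> ideal_J"
  unfolding mem_ideal_J_iff
proof (elim exE conjE)
  fix m n m' n' :: int
  assume "a = eis m n" "3 dvd m - n" "b = eis m' n'" "3 dvd m' - n'"
  then show "\<exists>m n. a + b = eis (of_int m) (of_int n) \<and> 3 dvd m - n"
    by (intro exI[of _ "m + m'"] exI[of _ "n + n'"]) (simp, presburger)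
qed

lemma ideal_J_uminus: "a \<in> ideal_J \<Longrightarrow> - a \<in> ideal_J"
  unfolding mem_ideal_J_iff
proof (elim exE conjE)
  fix m n :: int
  assume "a = eis m n" "3 dvd m - n"
  then show "\<exists>m n. - a = eis (of_int m) (of_int n) \<and> 3 dvd m - n"
    by (intro exI[of _ "- m"] exI[of _ "- n"]) (simp, presburger)
qed

lemma ideal_J_diff: "a \<in> ideal_J \<Longrightarrow> b \<in> ideal_J \<Longrightarrow> a - b \<in> ideal_J"
  using ideal_J_add[of a "- b"] ideal_J_uminus[of b] by simp

lemma short_ideal_J: "e \<in> short_vecs \<Longrightarrow> e \<in> ideal_J"
proof -
  have *: "eis (of_int m) (of_int n) \<in> ideal_J" if "3 dvd m - n" for m n :: int
    using that mem_ideal_J_iff by blast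
  show "e \<in> ideal_J" if "e \<in> short_vecs"
    using that *[of 1 1] *[of "-1" 2] *[of "-2" 1] *[of "-1" "-1"] *[of 1 "-2"] *[of 2 "-1"]
    by (auto simp: short_vecs_def)
qed

text \<open>Inner products of lattice vectors are multiples of 3/2. The lines through the sides of
  the hexagonal tiles have the form \<open>x \<bullet> e = 3 / 2 * k\<close>.\<close>

lemma ideal_J_inner_short:
  assumes "b \<in> ideal_J" "e \<in> short_vecs"
  obtains k :: int where "b \<bullet> e = 3 / 2 * of_int k"
proof -
  obtain m n :: int where b: "b = eis m n"
    using assms(1) mem_ideal_J_iff by blast
  have "\<exists>k::int. b \<bullet> e = 3 / 2 * of_int k"
    using assms(2) unfolding b short_vecs_def
  proof (elim insertE emptyE)
    assume "e = eis 1 1" then show "\<exists>k::int. eis m n \<bullet> e = 3 / 2 * of_int k"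
      by (intro exI[of _ "m + n"]) (simp add: inner_eis field_simps)
  next
    assume "e = eis (- 1) 2" then show "\<exists>k::int. eis m n \<bullet> e = 3 / 2 * of_int k"
      by (intro exI[of _ "n"]) (simp add: inner_eis field_simps)
  next
    assume "e = eis (- 2) 1" then show "\<exists>k::int. eis m n \<bullet> e = 3 / 2 * of_int k"
      by (intro exI[of _ "- m"]) (simp add: inner_eis field_simps)
  next
    assume "e = eis (- 1) (- 1)" then show "\<exists>k::int. eis m n \<bullet> e = 3 / 2 * of_int k"
      by (intro exI[of _ "- (m + n)"]) (simp add: inner_eis field_simps)
  next
    assume "e = eis 1 (- 2)" then show "\<exists>k::int. eis m n \<bullet> e = 3 / 2 * of_int k"
      by (intro exI[of _ "- n"]) (simp add: inner_eis field_simps)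
  next
    assume "e = eis 2 (- 1)" then show "\<exists>k::int. eis m n \<bullet> e = 3 / 2 * of_int k"
      by (intro exI[of _ "m"]) (simp add: inner_eis field_simps)
  qed
  then show ?thesis using that by blast
qed

text \<open>The norm of an ideal element is a multiple of 3 of the form
  \<open>m * m + m * n + n * n\<close>; after 0 and 3 the next such value is 9.\<close>

lemma ideal_J_cases:
  assumes "b \<in> ideal_J"
  obtains "b = 0" | "b \<in> short_vecs" | "3 \<le> cmod b"
proof -
  obtain m n :: int where b: "b = eis m n" and d: "3 dvd m - n"
    using assms mem_ideal_J_iff by blast
  have "b \<in> short_vecs" if "cmod b < 3" "b \<noteq> 0"
  proof -
    define S where "S = m * m + m * n + n * n"
    have "of_int S = b \<bullet> b"
      by (simp add: b inner_eis S_def)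
    also have "\<dots> < 9" using that by (simp add: cmod_less_iff)
    finally have S: "S < 9" by linarith
    then have q: "m * m + m * n + n * n < 9" by (simp add: S_def)
    \<comment> \<open>Completing the square in either variable bounds both coordinates, which leaves
      a finite check.\<close>
    have eq: "4 * S = (2 * m + n)^2 + 3 * n^2"
      "4 * S = (2 * n + m)^2 + 3 * m^2"
      by (simp_all add: S_def power2_eq_square algebra_simps)
    have "3 * n^2 < 36" "3 * m^2 < 36"
      using S eq zero_le_power2[of "2 * m + n"] zero_le_power2[of "2 * n + m"] by linarith+
    then have "n^2 < 4^2" "m^2 < 4^2" by simp_all
    then have "\<bar>n\<bar> < 4" "\<bar>m\<bar> < 4"
      by (metis abs_numeral abs_le_square_iff not_le)+
    then have "m \<in> {-3,-2,-1,0,1,2,3}" "n \<in> {-3,-2,-1,0,1,2,3}" by auto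
    then have "(m, n) \<in> {(0,0),(1,1),(-1,2),(-2,1),(-1,-1),(1,-2),(2,-1)}"
      using q d by (elim insertE emptyE) simp_all
    then show ?thesis using that by (auto simp: b short_vecs_def)
  qed
  then show ?thesis using that by fastforce
qed

text \<open>After \<open>0\<close> and \<open>e\<close>, the lattice points nearest to
  \<open>e / 2\<close> are the apexes of the two equilateral triangles on this segment, at distance
  3/2.\<close>

lemma ideal_J_near_midpoint:
  assumes "p \<in> ideal_J" "e \<in> short_vecs" "cmod (p - e / 2) < 3 / 2"
  shows "p = 0 \<or> p = e"
proof -
  have e: "e \<bullet> e = 3" "cmod e = sqrt 3" using assms by (simp_all add: short_inner_self short_cmod)
  have "(p - e / 2) \<bullet> (p - e / 2) < 9 / 4"
    using assms(3) by (simp only: cmod_less_iff) (simp add: power2_eq_square)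
  moreover have "(p - e / 2) \<bullet> (p - e / 2) = p \<bullet> p - p \<bullet> e + 3 / 4"
    using e by (simp add: inner_diff_left inner_diff_right inner_commute inner_complex_def field_simps)
  ultimately have s: "p \<bullet> p - p \<bullet> e < 3 / 2" by simp
  from assms(1) show ?thesis
  proof (cases rule: ideal_J_cases)
    case 2
    from 2 assms(2) show ?thesis
      by (rule short_inner_cases) (use s short_inner_self[OF 2] e in auto)
  next
    case 3
    have "cmod p \<le> cmod (p - e / 2) + cmod (e / 2)"
      by (metis diff_add_cancel norm_triangle_ineq)
    then have "cmod p < 3 / 2 + sqrt 3 / 2" using assms(3) e by (simp add: norm_divide)
    moreover have "sqrt 3 < 2" by (simp add: real_less_lsqrt)
    ultimately show ?thesis using 3 by simp
  qed simp
qed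


section \<open>The hexagonal tiling\<close>

text \<open>\<open>z \<bullet> e < 3 / 2\<close> says that \<open>z\<close> is nearer to
  \<open>0\<close> than to \<open>e\<close>, so this is the open Voronoi cell of \<open>0\<close> in
  \<open>ideal_J\<close>.\<close>

definition hexagon :: "complex set" where
  "hexagon = {z. \<forall>e\<in>short_vecs. z \<bullet> e < 3 / 2}"

definition closed_hexagon :: "complex set" where
  "closed_hexagon = {z. \<forall>e\<in>short_vecs. z \<bullet> e \<le> 3 / 2}"

text \<open>The sixth roots of unity: units of the Eisenstein integers and vertices of the
  hexagon.\<close>

definition units :: "complex set" where
  "units = {eis 1 0, eis 0 1, eis (- 1) 1, eis (- 1) 0, eis 0 (- 1), eis 1 (- 1)}"

lemma eis_hexagon_iff: "eis a b \<in> hexagon \<longleftrightarrow> \<bar>a\<bar> < 1 \<and> \<bar>b\<bar> < 1 \<and> \<bar>a + b\<bar> < 1"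
  by (auto simp: hexagon_def short_vecs_def inner_eis field_simps abs_less_iff)

lemma eis_closed_hexagon_iff:
  "eis a b \<in> closed_hexagon \<longleftrightarrow> \<bar>a\<bar> \<le> 1 \<and> \<bar>b\<bar> \<le> 1 \<and> \<bar>a + b\<bar> \<le> 1"
  by (auto simp: closed_hexagon_def short_vecs_def inner_eis field_simps abs_le_iff)

lemma hexagon_subset_closed: "hexagon \<subseteq> closed_hexagon"
  by (auto simp: hexagon_def closed_hexagon_def less_imp_le)

lemma scaleR_eis [simp]: "c *\<^sub>R eis a b = eis (c * a) (c * b)"
  by (simp add: complex_eq_iff algebra_simps)

lemma zeta6_powers: "{zeta6 ^ k | k. k \<le> 5} = units"
proof -
  have "{zeta6 ^ k | k. k \<le> 5} = (\<lambda>k. zeta6 ^ k) ` {..5}" by auto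
  also have "{..5::nat} = {0, 1, 2, 3, 4, 5}" by auto
  finally show ?thesis
    by (simp add: units_def zeta6_eis one_eis eval_nat_numeral insert_commute)
qed

text \<open>One inclusion holds because the closed hexagon is an intersection of half-planes; for
  the other it is cut into six triangles with apex \<open>0\<close>.\<close>

lemma convex_hull_units: "convex hull units = closed_hexagon"
proof
  have cl: "closed_hexagon = (\<Inter>e\<in>short_vecs. {z. e \<bullet> z \<le> 3 / 2})"
    by (auto simp: closed_hexagon_def inner_commute)
  have "convex closed_hexagon"
    unfolding cl by (intro convex_INT convex_halfspace_le)
  moreover have "units \<subseteq> closed_hexagon"
    by (auto simp: units_def eis_closed_hexagon_iff)
  ultimately show "convex hull units \<subseteq> closed_hexagon"
    by (rule hull_minimal[rotated])
  have in_triangle: "s *\<^sub>R u + t *\<^sub>R v \<in> convex hull units"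
    if "u \<in> units" "v \<in> units" "0 \<le> s" "0 \<le> t" "s + t \<le> 1" for s t u v
  proof -
    have c: "convex (convex hull units)" by (rule convex_convex_hull)
    have "- u \<in> units" using that(1) by (auto simp: units_def)
    then have m: "u \<in> convex hull units" "- u \<in> convex hull units" "v \<in> convex hull units"
      using that by (auto intro: hull_inc)
    have "(1 / 2) *\<^sub>R u + (1 / 2) *\<^sub>R (- u) \<in> convex hull units"
      using m by (intro convexD[OF c]) auto
    then have 0: "0 \<in> convex hull units" by simp
    show ?thesis
    proof (cases "s + t = 0")
      case True
      then have "s = 0" "t = 0" using that by auto
      then show ?thesis using 0 by simp
    next
      case False
      then have "(s / (s + t)) *\<^sub>R u + (t / (s + t)) *\<^sub>R v \<in> convex hull units" (is "?y \<in> _")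
        using False that by (intro convexD[OF c m(1) m(3)]) (simp_all add: add_divide_distrib[symmetric])
      then have "(s + t) *\<^sub>R ?y + (1 - (s + t)) *\<^sub>R 0 \<in> convex hull units"
        using 0 that by (intro convexD[OF c, of ?y 0]) (assumption | simp)+
      then show ?thesis using False by (simp add: scaleR_add_right)
    qed
  qed
  show "closed_hexagon \<subseteq> convex hull units"
  proof
    fix z assume z: "z \<in> closed_hexagon"
    obtain a b where ab: "z = eis a b" by (rule ex_eis)
    have h: "\<bar>a\<bar> \<le> 1" "\<bar>b\<bar> \<le> 1" "\<bar>a + b\<bar> \<le> 1"
      using z by (simp_all add: ab eis_closed_hexagon_iff)
    consider "0 \<le> a" "0 \<le> b" | "a \<le> 0" "0 \<le> a + b" | "0 \<le> b" "a + b \<le> 0"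
      | "a \<le> 0" "b \<le> 0" | "0 \<le> a" "a + b \<le> 0" | "b \<le> 0" "0 \<le> a + b"
      by linarith
    then show "z \<in> convex hull units"
    proof cases
      case 1
      then show ?thesis
        using in_triangle[of "eis 1 0" "eis 0 1" a b] h by (simp add: ab units_def)
    next
      case 2
      then show ?thesis
        using in_triangle[of "eis 0 1" "eis (- 1) 1" "a + b" "- a"] h by (simp add: ab units_def)
    next
      case 3
      then show ?thesis
        using in_triangle[of "eis (- 1) 1" "eis (- 1) 0" b "- (a + b)"] h by (simp add: ab units_def)
    next
      case 4
      then show ?thesis
        using in_triangle[of "eis (- 1) 0" "eis 0 (- 1)" "- a" "- b"] h by (simp add: ab units_def)
    next
      case 5
      then show ?thesis
        using in_triangle[of "eis 0 (- 1)" "eis 1 (- 1)" "- (a + b)" a] h by (simp add: ab units_def)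
    next
      case 6
      then show ?thesis
        using in_triangle[of "eis 1 (- 1)" "eis 1 0" "- b" "a + b"] h by (simp add: ab units_def)
    qed
  qed
qed

lemma interior_closed_hexagon: "interior closed_hexagon = hexagon"
proof -
  have cl: "closed_hexagon = (\<Inter>e\<in>short_vecs. {z. e \<bullet> z \<le> 3 / 2})"
    by (auto simp: closed_hexagon_def inner_commute)
  have "interior closed_hexagon = (\<Inter>e\<in>short_vecs. {z. e \<bullet> z < 3 / 2})"
    unfolding cl short_vecs_def INT_insert interior_Int
    by (simp add: interior_halfspace_le del: le_divide_eq_numeral1 less_divide_eq_numeral1)
  also have "\<dots> = hexagon"
    by (auto simp: hexagon_def inner_commute)
  finally show ?thesis .
qed

lemma open_hexagon_eq: "open_hexagon = hexagon"
  by (simp add: open_hexagon_def zeta6_powers convex_hull_units interior_closed_hexagon)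

text \<open>Of each pair of opposite sides one is kept: \<open>a + b = - 1\<close>,
  \<open>a = 1\<close>, \<open>b = 1\<close>. The inequalities exclude all vertices, so the two
  vertices of the domain appear separately.\<close>

lemma eis_dom_U_iff:
  "eis a b \<in> dom_U \<longleftrightarrow>
     - 1 \<le> a + b \<and> a + b < 1 \<and> - 1 < a \<and> a \<le> 1 \<and> - 1 < b \<and> b \<le> 1
     \<or> (a = 0 \<and> b = - 1) \<or> (a = 1 \<and> b = - 1)"
proof -
  have s1: "eis a b \<in> open_segment zeta6 (- cnj zeta6) \<longleftrightarrow> b = 1 \<and> - 1 < a \<and> a < 0"
    by (auto simp: in_segment zeta6_eis intro!: exI[of _ "- a"])
  have s2: "eis a b \<in> open_segment (- zeta6) (- 1) \<longleftrightarrow> a + b = - 1 \<and> - 1 < a \<and> a < 0"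
    by (auto simp: in_segment zeta6_eis one_eis intro!: exI[of _ "- a"])
  have s3: "eis a b \<in> open_segment 1 (cnj zeta6) \<longleftrightarrow> a = 1 \<and> - 1 < b \<and> b < 0"
    by (auto simp: in_segment zeta6_eis one_eis intro!: exI[of _ "- b"])
  have s4: "eis a b \<in> {- zeta6, cnj zeta6} \<longleftrightarrow> (a = 0 \<and> b = - 1) \<or> (a = 1 \<and> b = - 1)"
    by (simp add: zeta6_eis)
  show ?thesis
    unfolding dom_U_def open_hexagon_eq Un_iff s1 s2 s3 s4 eis_hexagon_iff by argo
qed

lemma hexagon_subset_dom_U: "hexagon \<subseteq> dom_U"
  by (auto simp: dom_U_def open_hexagon_eq)

lemma dom_U_subset_closed_hexagon: "dom_U \<subseteq> closed_hexagon"
proof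
  fix z assume "z \<in> dom_U"
  moreover obtain a b where "z = eis a b" by (rule ex_eis)
  ultimately show "z \<in> closed_hexagon" by (auto simp: eis_dom_U_iff eis_closed_hexagon_iff)
qed

section \<open>Existence and uniqueness of the integral part\<close>

lemma tiling_exists: "\<exists>a\<in>ideal_J. z - a \<in> dom_U"
proof -
  obtain a b where z: "z = eis a b" by (rule ex_eis)
  \<comment> \<open>The conditions on \<open>a + b\<close> and \<open>- a\<close> are both closed
    below, like those of the floor. In these coordinates the lattice consists of the integer pairs
    with difference divisible by 3, so a unit square has a lattice point at one corner or at two
    diagonal ones. In the latter case \<open>b\<close>, the sum of the two coordinates,
    decides.\<close>
  define m n where "m = \<lfloor>a + b\<rfloor>" and "n = \<lfloor>- a\<rfloor>"
  have m: "of_int m \<le> a + b" "a + b < of_int m + 1" and n: "of_int n \<le> - a" "- a < of_int n + 1"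
    unfolding m_def n_def by linarith+
  have J: "eis (of_int i) (of_int j) \<in> ideal_J" if "3 dvd i - j" for i j :: int
    using that mem_ideal_J_iff by blast
  have "3 dvd m - n \<or> 3 dvd m - (n + 1) \<or> 3 dvd (m + 1) - n" by presburger
  then consider "3 dvd m - n" | "3 dvd m - (n + 1)" | "3 dvd (m + 1) - n" by blast
  then show ?thesis
  proof cases
    case 1
    show ?thesis
    proof (cases "b \<le> of_int (m + n) + 1")
      case True
      have "z - eis (of_int (- n)) (of_int (m + n)) \<in> dom_U"
        using True m n unfolding z eis_diff eis_dom_U_iff
          of_int_add of_int_diff of_int_minus of_int_1 of_int_numeral by argo
      moreover have "3 dvd (- n) - (m + n)" using 1 by presburger
      ultimately show ?thesis using J by blast
    next
      case False
      have "z - eis (of_int (- n - 1)) (of_int (m + n + 2)) \<in> dom_U"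
        using False m n unfolding z eis_diff eis_dom_U_iff
          of_int_add of_int_diff of_int_minus of_int_1 of_int_numeral by argo
      moreover have "3 dvd (- n - 1) - (m + n + 2)" using 1 by presburger
      ultimately show ?thesis using J by blast
    qed
  next
    case 2
    have "z - eis (of_int (- n - 1)) (of_int (m + n + 1)) \<in> dom_U"
      using m n unfolding z eis_diff eis_dom_U_iff
          of_int_add of_int_diff of_int_minus of_int_1 of_int_numeral by argo
    moreover have "3 dvd (- n - 1) - (m + n + 1)" using 2 by presburger
    ultimately show ?thesis using J by blast
  next
    case 3
    have "z - eis (of_int (- n)) (of_int (m + n + 1)) \<in> dom_U"
      using m n unfolding z eis_diff eis_dom_U_iff
          of_int_add of_int_diff of_int_minus of_int_1 of_int_numeral by argo
    moreover have "3 dvd (- n) - (m + n + 1)" using 3 by presburger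
    ultimately show ?thesis using J by blast
  qed
qed

lemma tiling_unique:
  assumes "x \<in> dom_U" "x + d \<in> dom_U" "d \<in> ideal_J"
  shows "d = 0"
proof -
  obtain a b where x: "x = eis a b" by (rule ex_eis)
  obtain m n :: int where d: "d = eis m n" and dvd: "3 dvd m - n"
    using assms(3) mem_ideal_J_iff by blast
  have U: "eis a b \<in> dom_U" "eis (a + m) (b + n) \<in> dom_U"
    using assms by (simp_all add: x d)
  have "\<bar>real_of_int m\<bar> < 3" "\<bar>real_of_int n\<bar> < 3"
    using U unfolding eis_dom_U_iff by (auto simp: abs_if)
  then have "\<bar>m\<bar> < 3" "\<bar>n\<bar> < 3" by linarith+
  then have mn: "m \<in> {-2,-1,0,1,2}" "n \<in> {-2,-1,0,1,2}" by auto
  have "m = 0 \<and> n = 0"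
    using mn dvd U unfolding eis_dom_U_iff
    by (elim insertE emptyE) (simp_all, argo+)
  then show ?thesis by (simp add: d)
qed

lemma tiling_ex1: "\<exists>!a. a \<in> ideal_J \<and> z - a \<in> dom_U"
proof (rule ex_ex1I)
  show "\<exists>a. a \<in> ideal_J \<and> z - a \<in> dom_U" using tiling_exists by blast
next
  fix a b assume ab: "a \<in> ideal_J \<and> z - a \<in> dom_U" "b \<in> ideal_J \<and> z - b \<in> dom_U"
  have "a - b = 0"
    by (rule tiling_unique[of "z - a"]) (use ab ideal_J_diff in auto)
  then show "a = b" by simp
qed

lemma J_part_eq_The: "J_part z = (THE a. a \<in> ideal_J \<and> z - a \<in> dom_U)"
proof -
  have "z \<in> (\<lambda>u. a + u) ` dom_U \<longleftrightarrow> z - a \<in> dom_U" for a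
    by (auto simp: image_iff intro!: bexI[of _ "z - a"])
  then show ?thesis by (simp add: J_part_def)
qed

lemma J_part_eqI: "a \<in> ideal_J \<Longrightarrow> z - a \<in> dom_U \<Longrightarrow> J_part z = a"
  unfolding J_part_eq_The using tiling_ex1[of z] by (intro the1_equality) auto

lemma J_part_in: "J_part z \<in> ideal_J" and J_part_diff: "z - J_part z \<in> dom_U"
  unfolding J_part_eq_The using theI'[OF tiling_ex1[of z]] by auto

text \<open>Two of \<open>a\<close>, \<open>b\<close>, \<open>- (a + b)\<close> have weakly equal
  sign, as the three sum to \<open>0\<close>. The norm is the square of the third minus the product
  of these two, hence at most 1, with equality only at vertices.\<close>

lemma closed_hexagon_cmod:
  assumes "z \<in> closed_hexagon"
  shows "cmod z < 1 \<or> z \<in> units"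
proof -
  obtain a b where z: "z = eis a b" by (rule ex_eis)
  have h: "\<bar>a\<bar> \<le> 1" "\<bar>b\<bar> \<le> 1" "\<bar>a + b\<bar> \<le> 1"
    using assms by (simp_all add: z eis_closed_hexagon_iff)
  then have sq: "a\<^sup>2 \<le> 1" "b\<^sup>2 \<le> 1" "(a + b)\<^sup>2 \<le> 1"
    by (simp_all add: abs_square_le_1)
  have N: "z \<bullet> z = (a + b)\<^sup>2 - a * b" "z \<bullet> z = a\<^sup>2 + b * (a + b)" "z \<bullet> z = b\<^sup>2 + a * (a + b)"
    by (simp_all add: z inner_eis power2_eq_square algebra_simps)
  have "z \<in> units" if "\<not> cmod z < 1"
  proof -
    have ge: "1 \<le> z \<bullet> z" using that by (simp add: cmod_less_iff)
    have "0 \<le> a * b \<or> b * (a + b) \<le> 0 \<or> a * (a + b) \<le> 0"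
      unfolding mult_le_0_iff zero_le_mult_iff by argo
    then consider "0 \<le> a * b" | "b * (a + b) \<le> 0" | "a * (a + b) \<le> 0"
      by blast
    then show ?thesis
    proof cases
      case 1
      then have "a * b = 0" "(a + b)\<^sup>2 = 1" using ge N(1) sq by linarith+
      then show ?thesis by (auto simp: z units_def power2_eq_1_iff)
    next
      case 2
      then have "b * (a + b) = 0" "a\<^sup>2 = 1" using ge N(2) sq by linarith+
      then show ?thesis by (auto simp: z units_def power2_eq_1_iff)
    next
      case 3
      then have "a * (a + b) = 0" "b\<^sup>2 = 1" using ge N(3) sq by linarith+
      then show ?thesis by (auto simp: z units_def power2_eq_1_iff)
    qed
  qed
  then show ?thesis by blast
qed

lemma units_cmod: "u \<in> units \<Longrightarrow> cmod u = 1"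
  by (auto simp: units_def norm_eq_sqrt_inner inner_eis)

lemma hexagon_cmod: "z \<in> hexagon \<Longrightarrow> cmod z < 1"
proof -
  assume z: "z \<in> hexagon"
  then have "z \<notin> units" by (auto simp: units_def eis_hexagon_iff)
  then show ?thesis using z closed_hexagon_cmod hexagon_subset_closed by blast
qed

lemma dom_U_cmod: "z \<in> dom_U \<Longrightarrow> cmod z \<le> 1"
  using closed_hexagon_cmod[of z] dom_U_subset_closed_hexagon units_cmod by fastforce

lemma covering: "\<exists>b\<in>ideal_J. cmod (w + b) < 1 \<or> w + b \<in> units"
proof -
  obtain a where "a \<in> ideal_J" "w - a \<in> dom_U" using tiling_exists by blast
  then show ?thesis
    using closed_hexagon_cmod dom_U_subset_closed_hexagon ideal_J_uminus
    by (intro bexI[of _ "- a"]) auto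
qed


section \<open>Dual cells and the natural extension\<close>

lemma inner_divide_left: "x \<noteq> 0 \<Longrightarrow> (1 / x) \<bullet> y = (x \<bullet> cnj y) / (x \<bullet> x)" for x y :: complex
  by (simp add: inner_complex_def Re_divide Im_divide power2_eq_square divide_simps)

lemma inner_divide_self: "(1 / x) \<bullet> (1 / x) = 1 / (x \<bullet> x)" for x :: complex
  by (simp add: inner_self_cmod norm_divide power_divide)

lemma inner_self_pos: "x \<noteq> 0 \<Longrightarrow> 0 < x \<bullet> x" for x :: complex
  by simp

text \<open>In terms of \<open>w \<bullet> w\<close> and \<open>w \<bullet> e\<close>, disc
  conditions pass through the inversion by a mere division.\<close>

lemma cmod_diff_short:
  assumes "e \<in> short_vecs"
  shows "1 < cmod (w - e) \<longleftrightarrow> 2 * (w \<bullet> e) < w \<bullet> w + 2"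
    and "1 \<le> cmod (w - e) \<longleftrightarrow> 2 * (w \<bullet> e) \<le> w \<bullet> w + 2"
proof -
  have "(w - e) \<bullet> (w - e) = w \<bullet> w - 2 * (w \<bullet> e) + 3"
    using short_inner_self[OF assms] by (simp add: inner_diff_left inner_diff_right inner_commute)
  then show "1 < cmod (w - e) \<longleftrightarrow> 2 * (w \<bullet> e) < w \<bullet> w + 2" "1 \<le> cmod (w - e) \<longleftrightarrow> 2 * (w \<bullet> e) \<le> w \<bullet> w + 2"
    by (auto simp: less_cmod_iff le_cmod_iff)
qed

lemma cmod_diff_half_short:
  assumes "e \<in> short_vecs"
  shows "1 / 2 < cmod (w - e / 2) \<longleftrightarrow> w \<bullet> e < w \<bullet> w + 1 / 2"
    and "1 / 2 \<le> cmod (w - e / 2) \<longleftrightarrow> w \<bullet> e \<le> w \<bullet> w + 1 / 2"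
proof -
  have half_nonneg: "0 \<le> (1 / 2 :: real)" by simp
  have h: "e / 2 = (1 / 2) *\<^sub>R e" by (simp add: scaleR_conv_of_real)
  have "(w - e / 2) \<bullet> (w - e / 2) = w \<bullet> w - w \<bullet> e + 3 / 4"
    unfolding h using short_inner_self[OF assms] by (simp add: inner_diff_left inner_diff_right inner_commute)
  then show "1 / 2 < cmod (w - e / 2) \<longleftrightarrow> w \<bullet> e < w \<bullet> w + 1 / 2"
    "1 / 2 \<le> cmod (w - e / 2) \<longleftrightarrow> w \<bullet> e \<le> w \<bullet> w + 1 / 2"
    unfolding less_cmod_iff[OF half_nonneg] le_cmod_iff[OF half_nonneg] by (auto simp: power2_eq_square)
qed

text \<open>Inversion exchanges the circle of radius 1 about \<open>e\<close> and the circle of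
  radius 1/2 about \<open>cnj e / 2\<close>; outsides correspond because \<open>0\<close> lies
  outside both.\<close>

lemma cmod_inverse_diff_short:
  assumes "e \<in> short_vecs" "v \<noteq> 0"
  shows "1 < cmod (1 / v - e) \<longleftrightarrow> 1 / 2 < cmod (v - cnj e / 2)"
    and "1 \<le> cmod (1 / v - e) \<longleftrightarrow> 1 / 2 \<le> cmod (v - cnj e / 2)"
    and "1 / 2 < cmod (1 / v - e / 2) \<longleftrightarrow> 1 < cmod (v - cnj e)"
    and "1 / 2 \<le> cmod (1 / v - e / 2) \<longleftrightarrow> 1 \<le> cmod (v - cnj e)"
  unfolding cmod_diff_short[OF assms(1)] cmod_diff_half_short[OF assms(1)]
    cmod_diff_short[OF short_cnj[OF assms(1)]] cmod_diff_half_short[OF short_cnj[OF assms(1)]]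
    inner_divide_self inner_divide_left[OF assms(2)]
  using inner_self_pos[OF assms(2)] by (auto simp: field_simps)

text \<open>
  With \<open>r = sqrt 3 / 3\<close> and \<open>e \<bullet> e = 3\<close>, the inequality \<open>z \<bullet> z < 2 / 3 * (z \<bullet> e)\<close> means
  \<open>|z - e/3| < r\<close>, and \<open>z \<bullet> z + 1 < 4 / 3 * (z \<bullet> e)\<close> means \<open>|z - 2e/3| < r\<close>.
\<close>

definition generic :: "complex set" where
  "generic = {z \<in> hexagon. \<forall>e\<in>short_vecs. z \<bullet> e \<noteq> 0 \<and> z \<bullet> z \<noteq> 2 / 3 * (z \<bullet> e) \<and> z \<bullet> z + 1 \<noteq> 4 / 3 * (z \<bullet> e)}"

definition dual_dom :: "complex \<Rightarrow> complex set" where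
  "dual_dom z = {w. 1 < cmod w \<and> (\<forall>e\<in>short_vecs.
     (z \<bullet> z < 2 / 3 * (z \<bullet> e) \<longrightarrow> 1 / 2 < cmod (w - e / 2)) \<and>
     (z \<bullet> z + 1 < 4 / 3 * (z \<bullet> e) \<longrightarrow> 1 < cmod (w - e)))}"

definition closed_dual_dom :: "complex \<Rightarrow> complex set" where
  "closed_dual_dom z = {w. 1 \<le> cmod w \<and> (\<forall>e\<in>short_vecs.
     (z \<bullet> z < 2 / 3 * (z \<bullet> e) \<longrightarrow> 1 / 2 \<le> cmod (w - e / 2)) \<and>
     (z \<bullet> z + 1 < 4 / 3 * (z \<bullet> e) \<longrightarrow> 1 \<le> cmod (w - e)))}"

text \<open>
  The image of \<open>dual_dom (1 / u)\<close>, together with \<open>\<infinity>\<close>, under \<open>w \<mapsto> 1 / w\<close>. Inversion turns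
  the circles through \<open>0\<close> into lines, which explains the condition \<open>3 / 2 < u \<bullet> e\<close>.
\<close>

definition inv_dual_dom :: "complex \<Rightarrow> complex set" where
  "inv_dual_dom u = {v. cmod v < 1 \<and> (\<forall>e\<in>short_vecs.
     (3 / 2 < u \<bullet> e \<longrightarrow> 1 < cmod (v - e)) \<and>
     (u \<bullet> u + 1 < 4 / 3 * (u \<bullet> e) \<longrightarrow> 1 / 2 < cmod (v - e / 2)))}"

definition closed_inv_dual_dom :: "complex \<Rightarrow> complex set" where
  "closed_inv_dual_dom u = {v. cmod v \<le> 1 \<and> (\<forall>e\<in>short_vecs.
     (3 / 2 < u \<bullet> e \<longrightarrow> 1 \<le> cmod (v - e)) \<and>
     (u \<bullet> u + 1 < 4 / 3 * (u \<bullet> e) \<longrightarrow> 1 / 2 \<le> cmod (v - e / 2)))}"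

text \<open>The inequality puts \<open>u\<close> outside the closed disc of radius \<open>r\<close>
  about \<open>e / 3\<close>; for nonzero \<open>u\<close> this means
  \<open>1 / u \<in> hexagon\<close>. For generic \<open>z\<close>, the admissible
  \<open>z + b\<close> are the inverses of the preimages of \<open>z\<close> with digit
  \<open>b\<close>.\<close>

definition admissible :: "complex \<Rightarrow> bool" where
  "admissible u \<longleftrightarrow> (\<forall>e\<in>short_vecs. 2 / 3 * (u \<bullet> e) < u \<bullet> u)"

lemma dual_dom_subset_closed: "dual_dom z \<subseteq> closed_dual_dom z"
  by (auto simp: dual_dom_def closed_dual_dom_def less_imp_le)

lemma divide_compare:
  fixes s t :: real
  assumes "0 < s"
  shows "1 / s + 1 < 4 / 3 * (t / s) \<longleftrightarrow> s + 1 < 4 / 3 * t"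
    and "1 / s + 1 = 4 / 3 * (t / s) \<longleftrightarrow> s + 1 = 4 / 3 * t"
proof -
  have "1 / s + 1 = (s + 1) / s" "4 / 3 * (t / s) = (4 / 3 * t) / s"
    using assms by (simp_all add: field_simps)
  then show "1 / s + 1 < 4 / 3 * (t / s) \<longleftrightarrow> s + 1 < 4 / 3 * t"
    "1 / s + 1 = 4 / 3 * (t / s) \<longleftrightarrow> s + 1 = 4 / 3 * t"
    using assms by (simp_all only: divide_less_cancel divide_cancel_right) auto
qed

text \<open>The circle about \<open>e / 3\<close> passes through \<open>0\<close>, so inversion
  makes it a line; the circle about \<open>2 * e / 3\<close> is orthogonal to the unit circle, so
  \<open>1 / x\<close> runs through its mirror image in the real axis.\<close>

lemma inverse_disc_iff:
  assumes "x \<noteq> 0"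
  shows "(1 / x) \<bullet> (1 / x) < 2 / 3 * ((1 / x) \<bullet> e) \<longleftrightarrow> 3 / 2 < x \<bullet> cnj e"
    and "(1 / x) \<bullet> (1 / x) + 1 < 4 / 3 * ((1 / x) \<bullet> e) \<longleftrightarrow> x \<bullet> x + 1 < 4 / 3 * (x \<bullet> cnj e)"
    and "(1 / x) \<bullet> (1 / x) = 2 / 3 * ((1 / x) \<bullet> e) \<longleftrightarrow> x \<bullet> cnj e = 3 / 2"
    and "(1 / x) \<bullet> (1 / x) + 1 = 4 / 3 * ((1 / x) \<bullet> e) \<longleftrightarrow> x \<bullet> x + 1 = 4 / 3 * (x \<bullet> cnj e)"
    and "(1 / x) \<bullet> e = 0 \<longleftrightarrow> x \<bullet> cnj e = 0"
    and "(1 / x) \<bullet> e < 3 / 2 \<longleftrightarrow> 2 / 3 * (x \<bullet> cnj e) < x \<bullet> x"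
    and "(1 / x) \<bullet> e \<le> 3 / 2 \<longleftrightarrow> 2 / 3 * (x \<bullet> cnj e) \<le> x \<bullet> x"
  unfolding inner_divide_self inner_divide_left[OF assms] divide_compare[OF inner_self_pos[OF assms]]
  using inner_self_pos[OF assms] by (auto simp: field_simps)

lemma ball_short_cnj: "(\<forall>e\<in>short_vecs. P (cnj e)) \<longleftrightarrow> (\<forall>e\<in>short_vecs. P e)"
  by (metis complex_cnj_cnj short_cnj)

lemma short_vecs_nonempty: "eis 1 1 \<in> short_vecs"
  by (simp add: short_vecs_def)

lemma admissible_nonzero: "admissible u \<Longrightarrow> u \<noteq> 0"
  using short_vecs_nonempty by (auto simp: admissible_def)

lemma inverse_hexagon_iff: "u \<noteq> 0 \<Longrightarrow> 1 / u \<in> hexagon \<longleftrightarrow> admissible u"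
  unfolding hexagon_def admissible_def mem_Collect_eq inverse_disc_iff
  by (rule ball_short_cnj)

lemma inverse_closed_hexagon_iff:
  "u \<noteq> 0 \<Longrightarrow> 1 / u \<in> closed_hexagon \<longleftrightarrow> (\<forall>e\<in>short_vecs. 2 / 3 * (u \<bullet> e) \<le> u \<bullet> u)"
  unfolding closed_hexagon_def mem_Collect_eq inverse_disc_iff
  by (rule ball_short_cnj)

lemma dual_dom_inverse:
  assumes "w \<in> dual_dom (1 / u)" "u \<noteq> 0"
  shows "1 / w \<in> inv_dual_dom u"
proof -
  have w: "1 < cmod w" "w \<noteq> 0" using assms by (auto simp: dual_dom_def)
  have "(3 / 2 < u \<bullet> e \<longrightarrow> 1 < cmod (1 / w - e)) \<and>
     (u \<bullet> u + 1 < 4 / 3 * (u \<bullet> e) \<longrightarrow> 1 / 2 < cmod (1 / w - e / 2))" if "e \<in> short_vecs" for e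
    using assms(1) short_cnj[OF that]
    unfolding dual_dom_def mem_Collect_eq inverse_disc_iff[OF assms(2)]
      cmod_inverse_diff_short[OF that w(2)] by fastforce
  then show ?thesis using w by (simp add: inv_dual_dom_def norm_divide)
qed

lemma closed_inv_dual_dom_inverse:
  assumes "v \<in> closed_inv_dual_dom u" "u \<noteq> 0" "v \<noteq> 0"
  shows "1 / v \<in> closed_dual_dom (1 / u)"
proof -
  have "cmod v \<le> 1" using assms by (auto simp: closed_inv_dual_dom_def)
  then have "1 \<le> cmod (1 / v)" using assms by (simp add: norm_divide)
  moreover have "(3 / 2 < u \<bullet> cnj e \<longrightarrow> 1 / 2 \<le> cmod (1 / v - e / 2)) \<and>
     (u \<bullet> u + 1 < 4 / 3 * (u \<bullet> cnj e) \<longrightarrow> 1 \<le> cmod (1 / v - e))" if "e \<in> short_vecs" for e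
    using assms(1) short_cnj[OF that]
    unfolding closed_inv_dual_dom_def mem_Collect_eq cmod_inverse_diff_short[OF that assms(3)] by fastforce
  ultimately show ?thesis
    unfolding closed_dual_dom_def mem_Collect_eq inverse_disc_iff[OF assms(2)] by blast
qed

section \<open>Lattice translates of the hexagon that meet the bounding discs\<close>

lemma short_inner_le:
  assumes "f \<in> short_vecs" "e \<in> short_vecs" "f \<noteq> e"
  shows "f \<bullet> e \<le> 3 / 2"
  using assms(1,2) by (rule short_inner_cases) (use assms short_inner_self in auto)

text \<open>Cauchy-Schwarz for a disc of radius \<open>sqrt 3 / 3\<close> and a vector of length
  \<open>sqrt 3\<close>; the bound 1 separates such discs from tiles.\<close>

lemma disc_abs_inner_short_le:
  assumes "x \<bullet> x \<le> 1 / 3" "e \<in> short_vecs"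
  shows "\<bar>x \<bullet> e\<bar> \<le> 1"
proof -
  have "(x \<bullet> e)\<^sup>2 \<le> (x \<bullet> x) * (e \<bullet> e)" by (rule Cauchy_Schwarz_ineq)
  then have "(x \<bullet> e)\<^sup>2 \<le> 1" using assms short_inner_self by simp
  then show ?thesis by (simp add: abs_square_le_1)
qed

lemma inner_short_le:
  assumes "e \<in> short_vecs" shows "x \<bullet> e \<le> 7 / 4 * cmod x"
proof -
  have "sqrt 3 \<le> 7 / 4" by (rule real_le_lsqrt) (auto simp: power2_eq_square)
  then have "sqrt 3 * cmod x \<le> 7 / 4 * cmod x" by (rule mult_right_mono) simp
  then show ?thesis using abs_inner_short_le[OF assms, of x] by linarith
qed

lemma shift_cmod_gt_2:
  assumes "z \<in> hexagon" "3 \<le> cmod b" shows "2 < cmod (z + b)"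
  using hexagon_cmod[OF assms(1)] assms(2) norm_diff_ineq[of b z] by (simp add: add.commute)

text \<open>For a neighbour \<open>b\<close> other than \<open>e\<close>, the offset
  \<open>x\<close> from the centre \<open>e / 3\<close> would satisfy
  \<open>x \<bullet> b > 1\<close>, too much for the disc. Farther tiles lie beyond distance 2 from
  \<open>0\<close>.\<close>

lemma small_disc_shift:
  assumes z: "z \<in> hexagon" and b: "b \<in> ideal_J" and e: "e \<in> short_vecs"
    and le: "(z + b) \<bullet> (z + b) \<le> 2 / 3 * ((z + b) \<bullet> e)"
  shows "b = 0 \<or> b = e"
  using b
proof (cases rule: ideal_J_cases)
  case 2
  have "b = e" if ne: "b \<noteq> e"
  proof -
    have be: "b \<bullet> e \<le> 3 / 2"
      using 2 e ne by (rule short_inner_le)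
    define x where "x = z + b - (1 / 3) *\<^sub>R e"
    have "x \<bullet> x = (z + b) \<bullet> (z + b) - 2 / 3 * ((z + b) \<bullet> e) + 1 / 3"
      unfolding x_def using short_inner_self[OF e]
      by (simp add: inner_diff_left inner_diff_right inner_commute)
    then have "\<bar>x \<bullet> b\<bar> \<le> 1"
      using le 2 by (intro disc_abs_inner_short_le) auto
    moreover have "x \<bullet> b = z \<bullet> b + 3 - (b \<bullet> e) / 3"
      unfolding x_def using short_inner_self[OF 2]
      by (simp add: inner_diff_left inner_add_left inner_commute[of e b])
    moreover have "z \<bullet> (- b) < 3 / 2"
      using z short_uminus[OF 2] unfolding hexagon_def by blast
    ultimately show ?thesis using be by simp
  qed
  then show ?thesis by blast
next
  case 3
  let ?t = "cmod (z + b)"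
  have t: "2 < ?t" using z 3 by (rule shift_cmod_gt_2)
  have "?t\<^sup>2 \<le> 7 / 6 * ?t"
    using le inner_short_le[OF e, of "z + b"] by (simp add: inner_self_cmod)
  moreover have "2 * ?t \<le> ?t\<^sup>2"
    unfolding power2_eq_square using t by (intro mult_right_mono) auto
  ultimately show ?thesis using t by linarith
qed simp

text \<open>The separating direction depends on the angle: \<open>e\<close> for the opposite tile,
  \<open>b - e\<close> at 60 degrees and \<open>b\<close> at 120 degrees.\<close>

lemma big_disc_shift:
  assumes z: "z \<in> hexagon" and b: "b \<in> ideal_J" and e: "e \<in> short_vecs"
    and le: "(z + b) \<bullet> (z + b) + 1 \<le> 4 / 3 * ((z + b) \<bullet> e)"
  shows "b = 0 \<or> b = e"
  using b
proof (cases rule: ideal_J_cases)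
  case 2
  have sz: "z \<bullet> g < 3 / 2" if "g \<in> short_vecs" for g
    using z that unfolding hexagon_def by blast
  have bb: "b \<bullet> b = 3" and ee: "e \<bullet> e = 3" using 2 e short_inner_self by auto
  define x where "x = z + b - (2 / 3) *\<^sub>R e"
  have "x \<bullet> x = (z + b) \<bullet> (z + b) - 4 / 3 * ((z + b) \<bullet> e) + 4 / 3"
    unfolding x_def using ee by (simp add: inner_diff_left inner_diff_right inner_commute)
  then have xg: "\<bar>x \<bullet> g\<bar> \<le> 1" if "g \<in> short_vecs" for g
    using le that by (intro disc_abs_inner_short_le) auto
  have xe: "x \<bullet> g = z \<bullet> g + b \<bullet> g - 2 / 3 * (e \<bullet> g)" for g
    unfolding x_def by (simp add: inner_diff_left inner_add_left)
  from 2 e show ?thesis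
  proof (cases rule: short_inner_cases)
    case 2
    then show ?thesis using xg[OF e] sz[OF e] ee by (simp add: xe)
  next
    case 3
    have "- (b - e) \<in> short_vecs" using 3 by (simp del: minus_diff_eq)
    then have "z \<bullet> (- (b - e)) < 3 / 2" by (rule sz)
    moreover have "x \<bullet> (b - e) = z \<bullet> (b - e) + 5 / 2"
      using 3(1) bb ee by (simp add: xe inner_diff_right inner_commute[of e b])
    ultimately show ?thesis using xg[OF 3(2)] by (simp only: inner_minus_right abs_le_iff) linarith
  next
    case 4
    have "z \<bullet> (- b) < 3 / 2" by (rule sz[OF short_uminus[OF \<open>b \<in> short_vecs\<close>]])
    moreover have "x \<bullet> b = z \<bullet> b + 4"
      using 4(1) bb ee by (simp add: xe inner_commute[of e b])
    ultimately show ?thesis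
      using xg[OF \<open>b \<in> short_vecs\<close>] by (simp only: inner_minus_right abs_le_iff) linarith
  qed simp
next
  case 3
  let ?t = "cmod (z + b)"
  have t: "2 < ?t" using z 3 by (rule shift_cmod_gt_2)
  have "?t\<^sup>2 + 1 \<le> 7 / 3 * ?t"
    using le inner_short_le[OF e, of "z + b"] by (simp add: inner_self_cmod)
  moreover have "?t\<^sup>2 - 7 / 3 * ?t + 1 = (?t - 2) * (?t - 1 / 3) + 1 / 3"
    by (simp add: power2_eq_square algebra_simps)
  moreover have "0 \<le> (?t - 2) * (?t - 1 / 3)" using t by simp
  ultimately show ?thesis by linarith
qed simp

section \<open>Inverse branches over generic points\<close>

lemma generic_hexagon: "z \<in> generic \<Longrightarrow> z \<in> hexagon"
  by (simp add: generic_def)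

lemma generic_nonzero: "z \<in> generic \<Longrightarrow> z \<noteq> 0"
  using short_vecs_nonempty by (auto simp: generic_def)

text \<open>By \<open>small_disc_shift\<close> only \<open>e = b\<close> can violate admissibility.
  Since \<open>z + b - b / 3 = z - 2 / 3 * (- b)\<close>, this would put \<open>z\<close> in the
  closed large disc of \<open>- b\<close>, whose boundary genericity excludes.\<close>

lemma admissible_shift:
  assumes z: "z \<in> generic" and b: "b \<in> ideal_J" "b \<noteq> 0"
    and nb: "b \<in> short_vecs \<Longrightarrow> \<not> z \<bullet> z + 1 < 4 / 3 * (z \<bullet> (- b))"
  shows "admissible (z + b)"
  unfolding admissible_def
proof (intro ballI, rule ccontr)
  fix e assume e: "e \<in> short_vecs" and n: "\<not> 2 / 3 * ((z + b) \<bullet> e) < (z + b) \<bullet> (z + b)"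
  have be: "b = e"
    using small_disc_shift[OF generic_hexagon[OF z] b(1) e] n b(2) by auto
  then have "z \<bullet> z + 1 \<le> 4 / 3 * (z \<bullet> (- b))"
    using n short_inner_self[OF e] by (simp add: inner_add_left inner_add_right inner_commute)
  moreover have "z \<bullet> z + 1 \<noteq> 4 / 3 * (z \<bullet> (- b))"
    using z e be short_uminus[OF e] unfolding generic_def by blast
  ultimately show False using nb e be by simp
qed

lemma admissible_shiftD:
  assumes z: "z \<in> generic" and adm: "admissible (z + b)"
  shows "b \<noteq> 0" and "b \<in> short_vecs \<Longrightarrow> \<not> z \<bullet> z + 1 < 4 / 3 * (z \<bullet> (- b))"
proof -
  have "cmod z < 1" "z \<noteq> 0"
    using z generic_hexagon hexagon_cmod generic_nonzero by auto
  moreover have "cmod (1 / z) < 1" if "b = 0"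
    using adm that inverse_hexagon_iff[OF \<open>z \<noteq> 0\<close>] hexagon_cmod by simp
  ultimately show "b \<noteq> 0" by (auto simp: norm_divide)
  assume b: "b \<in> short_vecs"
  then have "2 / 3 * ((z + b) \<bullet> b) < (z + b) \<bullet> (z + b)" using adm by (simp add: admissible_def)
  then show "\<not> z \<bullet> z + 1 < 4 / 3 * (z \<bullet> (- b))"
    using short_inner_self[OF b] by (simp add: inner_add_left inner_add_right inner_commute)
qed

text \<open>\<open>z \<bullet> e\<close> is then itself a multiple of 3/2, and it is less than 3/2
  in absolute value.\<close>

lemma inner_shift_eq_0:
  assumes z: "z \<in> hexagon" and b: "b \<in> ideal_J" and e: "e \<in> short_vecs"
    and k: "(z + b) \<bullet> e = 3 / 2 * of_int k"
  shows "z \<bullet> e = 0"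
proof -
  obtain l :: int where l: "b \<bullet> e = 3 / 2 * of_int l" using b e by (rule ideal_J_inner_short)
  have "z \<bullet> e < 3 / 2" "z \<bullet> (- e) < 3 / 2"
    using z e short_uminus[OF e] unfolding hexagon_def by blast+
  moreover obtain m :: int where m: "z \<bullet> e = 3 / 2 * of_int m"
    using k l by (intro that[of "k - l"]) (simp add: inner_add_left)
  ultimately have "\<bar>real_of_int m\<bar> < 1" unfolding inner_minus_right by linarith
  then have "m = 0" by linarith
  then show ?thesis using m by simp
qed

text \<open>The exceptional curves are preserved: lines through \<open>0\<close> and small circles
  at \<open>1 / (z + b)\<close> pull back to lines \<open>z \<bullet> e = 0\<close>, and a large
  circle pulls back to a small circle at \<open>z\<close>.\<close>

lemma generic_inverse_shift:
  assumes z: "z \<in> generic" and b: "b \<in> ideal_J" and adm: "admissible (z + b)"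
  shows "1 / (z + b) \<in> generic"
proof -
  let ?u = "z + b"
  have u: "?u \<noteq> 0" using adm by (rule admissible_nonzero)
  have zh: "z \<in> hexagon" using z by (rule generic_hexagon)
  have gen: "z \<bullet> e \<noteq> 0" "z \<bullet> z \<noteq> 2 / 3 * (z \<bullet> e)" "z \<bullet> z + 1 \<noteq> 4 / 3 * (z \<bullet> e)"
    if "e \<in> short_vecs" for e
    using z that by (auto simp: generic_def)
  have "?u \<bullet> e \<noteq> 0 \<and> ?u \<bullet> e \<noteq> 3 / 2 \<and> ?u \<bullet> ?u + 1 \<noteq> 4 / 3 * (?u \<bullet> e)" if e: "e \<in> short_vecs" for e
  proof (intro conjI notI)
    assume "?u \<bullet> e = 0"
    then show False using inner_shift_eq_0[OF zh b e, of 0] gen(1)[OF e] by simp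
  next
    assume "?u \<bullet> e = 3 / 2"
    then show False using inner_shift_eq_0[OF zh b e, of 1] gen(1)[OF e] by simp
  next
    assume eq: "?u \<bullet> ?u + 1 = 4 / 3 * (?u \<bullet> e)"
    then have "b = e"
      using big_disc_shift[OF zh b e] admissible_shiftD(1)[OF z adm] by auto
    then have "z \<bullet> z = 2 / 3 * (z \<bullet> (- e))"
      using eq short_inner_self[OF e] by (simp add: inner_add_left inner_add_right inner_commute)
    then show False using gen(2)[OF short_uminus[OF e]] by simp
  qed
  then have "\<forall>e\<in>short_vecs. ?u \<bullet> cnj e \<noteq> 0 \<and> ?u \<bullet> cnj e \<noteq> 3 / 2 \<and> ?u \<bullet> ?u + 1 \<noteq> 4 / 3 * (?u \<bullet> cnj e)"
    using short_cnj by blast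
  then show ?thesis
    using adm inverse_hexagon_iff[OF u] unfolding generic_def mem_Collect_eq inverse_disc_iff[OF u] by blast
qed

text \<open>Translated by \<open>b\<close>, the discs to be avoided are centred at \<open>b\<close>,
  \<open>b + e / 2\<close> or \<open>b + e\<close>. Either \<open>v\<close> already avoids such a
  disc by assumption, or the disc misses the open unit disc. Admissibility excludes the case
  \<open>b + e = 0\<close> for the last kind.\<close>

lemma dual_dom_forward:
  assumes z: "z \<in> generic" and b: "b \<in> ideal_J" and adm: "admissible (z + b)"
    and v: "v \<in> inv_dual_dom (z + b)"
  shows "v - b \<in> dual_dom z"
proof -
  let ?u = "z + b"
  have zh: "z \<in> hexagon" using z by (rule generic_hexagon)
  have zs: "z \<bullet> g < 3 / 2" if "g \<in> short_vecs" for g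
    using zh that unfolding hexagon_def by blast
  have v1: "cmod v < 1" using v by (simp add: inv_dual_dom_def)
  have va: "1 < cmod (v - e)" if "e \<in> short_vecs" "3 / 2 < ?u \<bullet> e" for e
    using v that by (simp add: inv_dual_dom_def)
  have vb: "1 / 2 < cmod (v - e / 2)" if "e \<in> short_vecs" "?u \<bullet> ?u + 1 < 4 / 3 * (?u \<bullet> e)" for e
    using v that by (simp add: inv_dual_dom_def)
  have b0: "b \<noteq> 0" and nb: "b \<in> short_vecs \<Longrightarrow> \<not> z \<bullet> z + 1 < 4 / 3 * (z \<bullet> (- b))"
    using admissible_shiftD[OF z adm] by auto
  have far: "cmod c - 1 < cmod (v - c)" for c
    using norm_triangle_ineq2[of c v] v1 by (simp add: norm_minus_commute)
  have 1: "1 < cmod (v - b)"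
    using b
  proof (cases rule: ideal_J_cases)
    case 2
    then have "3 / 2 < ?u \<bullet> b"
      using zs[OF short_uminus[OF 2]] short_inner_self[OF 2] by (simp add: inner_add_left)
    then show ?thesis using va 2 by blast
  next
    case 3
    then show ?thesis using far[of b] by simp
  qed (use b0 in simp)
  have 2: "1 / 2 < cmod (v - b - e / 2)" if e: "e \<in> short_vecs" and d: "z \<bullet> z < 2 / 3 * (z \<bullet> e)" for e
  proof (cases "b = - e")
    case True
    \<comment> \<open>Here \<open>z - e / 3 = ?u - 2 / 3 * b\<close>, so the small disc at
      \<open>z\<close> is the large disc at \<open>?u\<close>.\<close>
    then have "?u \<bullet> ?u + 1 < 4 / 3 * (?u \<bullet> b)"
      using d short_inner_self[OF e] by (simp add: inner_diff_left inner_diff_right inner_commute)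
    moreover have "b \<in> short_vecs" using True e by simp
    ultimately have "1 / 2 < cmod (v - b / 2)" by (intro vb)
    moreover have "v - b - e / 2 = v - b / 2" using True by (simp add: field_simps)
    ultimately show ?thesis by (simp only:)
  next
    case False
    have "\<not> cmod (- b - e / 2) < 3 / 2"
      using ideal_J_near_midpoint[OF ideal_J_uminus[OF b] e] False b0 by auto
    then have "3 / 2 \<le> cmod (b + e / 2)" by (metis add_uminus_conv_diff minus_add_distrib norm_minus_cancel not_less)
    then show ?thesis using far[of "b + e / 2"] by (simp add: diff_diff_eq)
  qed
  have 3: "1 < cmod (v - b - e)" if e: "e \<in> short_vecs" and d: "z \<bullet> z + 1 < 4 / 3 * (z \<bullet> e)" for e
    using ideal_J_add[OF b short_ideal_J[OF e]]
  proof (cases rule: ideal_J_cases)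
    case 1
    then have "b = - e" by (simp add: add_eq_0_iff2)
    then show ?thesis using nb d e by simp
  next
    case 2
    let ?f = "b + e"
    define x where "x = z - (2 / 3) *\<^sub>R e"
    have ee: "e \<bullet> e = 3" and ff: "?f \<bullet> ?f = 3" using e 2 short_inner_self by auto
    have "x \<bullet> x = z \<bullet> z - 4 / 3 * (z \<bullet> e) + 4 / 3"
      unfolding x_def using ee by (simp add: inner_diff_left inner_diff_right inner_commute)
    then have "\<bar>x \<bullet> ?f\<bar> \<le> 1" using d 2 by (intro disc_abs_inner_short_le) auto
    then have "2 / 3 * (e \<bullet> ?f) - 1 \<le> z \<bullet> ?f"
      unfolding x_def by (simp add: inner_diff_left)
    moreover have "?u \<bullet> ?f = z \<bullet> ?f + 3 - e \<bullet> ?f"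
      using ff by (simp add: inner_add_left)
    moreover have "?f \<bullet> e \<le> 3 / 2"
      using short_inner_le[OF 2 e] b0 by simp
    ultimately have ge: "3 / 2 \<le> ?u \<bullet> ?f" by (simp add: inner_commute[of e])
    \<comment> \<open>Equality would give \<open>z \<bullet> ?f = 0\<close>, which genericity
      excludes.\<close>
    have "?u \<bullet> ?f \<noteq> 3 / 2"
      using inner_shift_eq_0[OF zh b 2, of 1] z 2 by (auto simp: generic_def)
    then show ?thesis using va[OF 2] ge by (simp add: diff_diff_eq)
  next
    case 3
    then show ?thesis using far[of "b + e"] by (simp add: diff_diff_eq)
  qed
  show ?thesis using 1 2 3 by (simp add: dual_dom_def)
qed

text \<open>The case \<open>v = 0\<close>, which stands for the initial value
  \<open>w = \<infinity>\<close>.\<close>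

lemma dual_dom_digit: "z \<in> generic \<Longrightarrow> b \<in> ideal_J \<Longrightarrow> admissible (z + b) \<Longrightarrow> - b \<in> dual_dom z"
proof -
  have "0 \<in> inv_dual_dom u" for u
    by (auto simp: inv_dual_dom_def norm_divide short_cmod)
  then show "z \<in> generic \<Longrightarrow> b \<in> ideal_J \<Longrightarrow> admissible (z + b) \<Longrightarrow> - b \<in> dual_dom z"
    using dual_dom_forward[of z b 0] by simp
qed

text \<open>
  Every \<open>b\<close> with \<open>cmod (w + b) < 1\<close> meets all conditions, except perhaps
  \<open>1 \<le> cmod (w + b - e)\<close> for one \<open>e\<close> with \<open>3 / 2 < (z + b) \<bullet> e\<close>. If this one fails, \<open>b - e\<close> works.
\<close>

lemma closed_dual_dom_backward:
  assumes z: "z \<in> generic" and w: "w \<in> closed_dual_dom z"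
    and b0: "b0 \<in> ideal_J" "cmod (w + b0) < 1"
  obtains b where "b \<in> ideal_J" "cmod (w + b) < 1" "admissible (z + b)" "w + b \<in> closed_inv_dual_dom (z + b)"
proof -
  have zh: "z \<in> hexagon" using z by (rule generic_hexagon)
  have w1: "1 \<le> cmod w" using w by (simp add: closed_dual_dom_def)
  have adm: "admissible (z + b)" "b \<noteq> 0" if b: "b \<in> ideal_J" "cmod (w + b) < 1" for b
  proof -
    show b0: "b \<noteq> 0" using w1 b by auto
    show "admissible (z + b)"
    proof (rule admissible_shift[OF z b(1) b0])
      assume "b \<in> short_vecs"
      then have "- b \<in> short_vecs" by simp
      then have "z \<bullet> z + 1 < 4 / 3 * (z \<bullet> (- b)) \<longrightarrow> 1 \<le> cmod (w - (- b))"
        using w unfolding closed_dual_dom_def by blast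
      then show "\<not> z \<bullet> z + 1 < 4 / 3 * (z \<bullet> (- b))" using b by simp
    qed
  qed
  have big: "1 / 2 \<le> cmod (w + b - e / 2)"
    if b: "b \<in> ideal_J" "cmod (w + b) < 1" and e: "e \<in> short_vecs"
      and d: "(z + b) \<bullet> (z + b) + 1 < 4 / 3 * ((z + b) \<bullet> e)" for b e
  proof -
    \<comment> \<open>With \<open>b = e\<close>, the large disc of \<open>e\<close> at
      \<open>z + b\<close> is the small disc of \<open>- e\<close> at \<open>z\<close>.\<close>
    have be: "b = e" using big_disc_shift[OF zh b(1) e] d adm(2)[OF b] by auto
    then have "z \<bullet> z < 2 / 3 * (z \<bullet> (- e))"
      using d short_inner_self[OF e] by (simp add: inner_add_left inner_add_right inner_commute)
    moreover have "- e \<in> short_vecs" using e by simp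
    ultimately have "1 / 2 \<le> cmod (w - (- e) / 2)" using w unfolding closed_dual_dom_def by blast
    moreover have "w - (- e) / 2 = w + b - e / 2" using be by (simp add: field_simps)
    ultimately show ?thesis by (simp only:)
  qed
  show ?thesis
  proof (cases "\<exists>e\<in>short_vecs. 3 / 2 < (z + b0) \<bullet> e \<and> cmod (w + b0 - e) < 1")
    case False
    then have "w + b0 \<in> closed_inv_dual_dom (z + b0)"
      using b0 big[OF b0] by (auto simp: closed_inv_dual_dom_def not_less)
    then show ?thesis using that b0 adm(1)[OF b0] by blast
  next
    case True
    then obtain e where e: "e \<in> short_vecs" "3 / 2 < (z + b0) \<bullet> e" "cmod (w + b0 - e) < 1" by blast
    define b where "b = b0 - e"
    have b: "b \<in> ideal_J" "cmod (w + b) < 1"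
      using b0 e ideal_J_diff short_ideal_J by (simp_all add: b_def add_diff_eq)
    have "1 \<le> cmod (w + b - f)" if f: "f \<in> short_vecs" and d: "3 / 2 < (z + b) \<bullet> f" for f
    proof (rule ccontr)
      assume "\<not> 1 \<le> cmod (w + b - f)"
      then have n: "cmod (w + b0 - (e + f)) < 1" by (simp add: b_def algebra_simps)
      define v where "v = w + b0"
      have h: "e / 2 = (1 / 2) *\<^sub>R e" by (simp add: scaleR_conv_of_real)
      \<comment> \<open>By this median formula, a \<open>v\<close> within 1 of both \<open>0\<close>
        and \<open>e\<close> is within 1/2 of \<open>e / 2\<close>. Then \<open>e + f\<close> is
        within 3/2 of \<open>e / 2\<close>, which forces \<open>f = - e\<close>, and the two lower
        bounds \<open>3 / 2\<close> contradict each other.\<close>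
      have "(v - e / 2) \<bullet> (v - e / 2) = (v \<bullet> v + (v - e) \<bullet> (v - e)) / 2 - e \<bullet> e / 4"
        unfolding h by (simp add: inner_diff_left inner_diff_right inner_commute field_simps)
      moreover have "v \<bullet> v < 1" "(v - e) \<bullet> (v - e) < 1"
        using b0 e by (simp_all add: v_def cmod_less_iff)
      ultimately have "(v - e / 2) \<bullet> (v - e / 2) < (1 / 2)\<^sup>2"
        using short_inner_self[OF e(1)] by (simp add: power2_eq_square)
      then have "cmod (v - e / 2) < 1 / 2" by (simp only: cmod_less_iff)
      moreover have "cmod (e + f - e / 2) \<le> cmod (v - e / 2) + cmod (v - (e + f))"
        using norm_triangle_ineq4[of "v - e / 2" "v - (e + f)"] by simp
      ultimately have "cmod (e + f - e / 2) < 3 / 2" using n v_def by simp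
      then have "e + f = 0 \<or> e + f = e"
        using e f ideal_J_add short_ideal_J by (intro ideal_J_near_midpoint) auto
      then have "f = - e" using short_inner_self[OF f] by (auto simp: add_eq_0_iff)
      then show False using d e short_inner_self[OF e(1)]
        by (simp add: b_def inner_diff_left inner_add_left)
    qed
    then have "w + b \<in> closed_inv_dual_dom (z + b)"
      using b big[OF b] by (auto simp: closed_inv_dual_dom_def)
    then show ?thesis using that b adm(1)[OF b] by blast
  qed
qed


section \<open>Ratios of consecutive denominators\<close>

definition ratio_set :: "complex \<Rightarrow> complex set" where
  "ratio_set z0 = {- (cf_denom n z / cf_denom (n - 1) z) | n z.
     n \<ge> 1 \<and> z \<in> dom_U \<and> (cf_map ^^ n) z = z0}"

lemma cf_map_dom_U: "z \<in> dom_U \<Longrightarrow> cf_map z \<in> dom_U"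
  using J_part_diff by (cases "z = 0") (simp_all add: cf_map_def)

lemma funpow_cf_map_dom_U: "z \<in> dom_U \<Longrightarrow> (cf_map ^^ n) z \<in> dom_U"
  by (induction n) (auto intro: cf_map_dom_U)

text \<open>Membership in \<open>dom_U\<close> allows boundary points and gives only weak
  inequalities; genericity of \<open>z0\<close> makes them strict.\<close>

lemma cf_map_generic_preimage:
  assumes z: "z \<in> dom_U" and z0: "cf_map z = z0" "z0 \<in> generic"
  shows "1 / z = z0 + J_part (1 / z)" "z = 1 / (z0 + J_part (1 / z))"
    and "admissible (z0 + J_part (1 / z))" "z \<in> generic"
proof -
  define b where "b = J_part (1 / z)"
  \<comment> \<open>\<open>cf_map\<close> sends \<open>0\<close> to \<open>0\<close>, which is not
    generic.\<close>
  have zn: "z \<noteq> 0"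
    using z0(1) generic_nonzero[OF z0(2)] by (auto simp: cf_map_def)
  then have u: "1 / z = z0 + b"
    using z0 by (auto simp: cf_map_def b_def)
  then have zu: "z = 1 / (z0 + b)" and un: "z0 + b \<noteq> 0"
    using zn by (metis div_by_1 divide_divide_eq_right mult_1, metis divide_eq_0_iff one_neq_zero)
  have b: "b \<in> ideal_J" by (simp add: b_def J_part_in)
  have le: "2 / 3 * ((z0 + b) \<bullet> e) \<le> (z0 + b) \<bullet> (z0 + b)" if "e \<in> short_vecs" for e
    using z dom_U_subset_closed_hexagon that zu inverse_closed_hexagon_iff[OF un] by auto
  have "1 \<le> cmod (1 / z)" using dom_U_cmod[OF z] zn by (simp add: norm_divide)
  moreover have "cmod z0 < 1" using z0 generic_hexagon hexagon_cmod by blast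
  ultimately have b0: "b \<noteq> 0" using u by auto
  have adm: "admissible (z0 + b)"
  proof (rule admissible_shift[OF z0(2) b b0])
    assume s: "b \<in> short_vecs"
    show "\<not> z0 \<bullet> z0 + 1 < 4 / 3 * (z0 \<bullet> (- b))"
      using le[OF s] short_inner_self[OF s] by (simp add: inner_add_left inner_add_right inner_commute)
  qed
  then have "z \<in> generic"
    unfolding zu by (rule generic_inverse_shift[OF z0(2) b])
  then show "1 / z = z0 + J_part (1 / z)" "z = 1 / (z0 + J_part (1 / z))"
    "admissible (z0 + J_part (1 / z))" "z \<in> generic"
    using u zu adm unfolding b_def by blast+
qed

lemma admissible_preimage:
  assumes z0: "z0 \<in> generic" and b: "b \<in> ideal_J" and adm: "admissible (z0 + b)"
  shows "1 / (z0 + b) \<in> dom_U" "cf_map (1 / (z0 + b)) = z0" "J_part (z0 + b) = b"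
proof -
  show "1 / (z0 + b) \<in> dom_U"
    using generic_inverse_shift[OF assms] generic_hexagon hexagon_subset_dom_U by blast
  show J: "J_part (z0 + b) = b"
    using z0 generic_hexagon hexagon_subset_dom_U by (intro J_part_eqI[OF b]) auto
  show "cf_map (1 / (z0 + b)) = z0"
    using admissible_nonzero[OF adm] J by (simp add: cf_map_def)
qed

text \<open>The three-term recursion divided by \<open>cf_denom (Suc n) z\<close>: the second
  coordinate \<open>1 / w - b\<close> of the natural extension.\<close>

lemma ratio_recursion:
  assumes "cf_denom (Suc n) z \<noteq> 0"
  shows "- (cf_denom (Suc (Suc n)) z / cf_denom (Suc n) z) =
    1 / (- (cf_denom (Suc n) z / cf_denom n z)) - J_part (1 / (cf_map ^^ Suc n) z)"
  using assms by (simp add: cf_digit_def add_divide_distrib del: funpow.simps)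

text \<open>Induction along the orbit by \<open>dual_dom_forward\<close>, starting at index 1 with
  the negative of the first digit. The bound \<open>1 < cmod w\<close> also keeps the denominators
  nonzero.\<close>

lemma ratio_in_dual_dom:
  assumes "z \<in> dom_U" "(cf_map ^^ Suc n) z = z0" "z0 \<in> generic"
  shows "- (cf_denom (Suc n) z / cf_denom n z) \<in> dual_dom z0"
  using assms(2,3)
proof (induction n arbitrary: z0)
  case 0
  then have "cf_map z = z0" by simp
  note pre = cf_map_generic_preimage[OF assms(1) this 0(2)]
  show ?case
    using dual_dom_digit[OF 0(2) J_part_in pre(3)] by (simp add: cf_digit_def)
next
  case (Suc n)
  define y where "y = (cf_map ^^ Suc n) z"
  have y: "y \<in> dom_U" unfolding y_def by (rule funpow_cf_map_dom_U[OF assms(1)])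
  have yz: "cf_map y = z0" using Suc.prems by (simp add: y_def)
  note pre = cf_map_generic_preimage[OF y yz Suc.prems(2)]
  define b where "b = J_part (1 / y)"
  define w where "w = - (cf_denom (Suc n) z / cf_denom n z)"
  have w: "w \<in> dual_dom y" unfolding w_def by (rule Suc.IH[OF y_def[symmetric] pre(4)])
  then have "w \<noteq> 0" by (auto simp: dual_dom_def)
  then have q: "cf_denom (Suc n) z \<noteq> 0" by (auto simp: w_def simp del: cf_denom.simps)
  have adm: "admissible (z0 + b)" using pre(3) by (simp add: b_def)
  have "1 / w \<in> inv_dual_dom (z0 + b)"
    using dual_dom_inverse[of w "z0 + b"] w pre(2) admissible_nonzero[OF adm] by (simp add: b_def)
  then have "1 / w - b \<in> dual_dom z0"
    using J_part_in adm by (intro dual_dom_forward[OF Suc.prems(2)]) (auto simp: b_def)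
  then show ?case
    unfolding ratio_recursion[OF q] by (simp only: w_def b_def y_def)
qed

lemma ratio_set_subset: "z0 \<in> generic \<Longrightarrow> ratio_set z0 \<subseteq> dual_dom z0"
proof
  fix w assume z0: "z0 \<in> generic" and "w \<in> ratio_set z0"
  then obtain n z where w: "w = - (cf_denom n z / cf_denom (n - 1) z)" "1 \<le> n" "z \<in> dom_U" "(cf_map ^^ n) z = z0"
    by (auto simp: ratio_set_def)
  then obtain m where "n = Suc m" by (cases n) auto
  then show "w \<in> dual_dom z0" using ratio_in_dual_dom[of z m z0] w z0 by simp
qed

lemma ratio_set_digit:
  assumes z0: "z0 \<in> generic" and b: "b \<in> ideal_J" and adm: "admissible (z0 + b)"
  shows "- b \<in> ratio_set z0"
  unfolding ratio_set_def using admissible_preimage[OF assms]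
  by (intro CollectI exI[of _ 1] exI[of _ "1 / (z0 + b)"]) (simp add: cf_digit_def)

text \<open>An orbit ending at \<open>1 / (z0 + b)\<close> is prolonged by one step with digit
  \<open>b\<close>.\<close>

lemma ratio_set_step:
  assumes z0: "z0 \<in> generic" and b: "b \<in> ideal_J" and adm: "admissible (z0 + b)"
    and w: "w \<in> ratio_set (1 / (z0 + b))" "w \<noteq> 0"
  shows "1 / w - b \<in> ratio_set z0"
proof -
  obtain n z where n: "w = - (cf_denom n z / cf_denom (n - 1) z)" "1 \<le> n" "z \<in> dom_U"
      "(cf_map ^^ n) z = 1 / (z0 + b)"
    using w(1) by (auto simp: ratio_set_def)
  then obtain m where m: "n = Suc m" by (cases n) auto
  have q: "cf_denom (Suc m) z \<noteq> 0" using n(1) w(2) m by (auto simp del: cf_denom.simps)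
  have "(cf_map ^^ Suc (Suc m)) z = z0"
    using n(4) admissible_preimage(2)[OF assms(1-3)] m by simp
  moreover have "1 / w - b = - (cf_denom (Suc (Suc m)) z / cf_denom (Suc m) z)"
    unfolding ratio_recursion[OF q] using n m admissible_preimage(3)[OF assms(1-3)] by simp
  ultimately show ?thesis
    unfolding ratio_set_def using n(3)
    by (intro CollectI exI[of _ "Suc (Suc m)"] exI[of _ z]) (simp del: cf_denom.simps funpow.simps)
qed

section \<open>Eisenstein integers and the descent on quotients\<close>

lemma eis_of_int_ring: "eis (of_int m) (of_int n) \<in> eisenstein_ring"
  unfolding mem_eisenstein_ring_iff by blast

lemma eisenstein_ring_mult:
  assumes "a \<in> eisenstein_ring" "b \<in> eisenstein_ring"
  shows "a * b \<in> eisenstein_ring"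
proof -
  obtain m n m' n' :: int where "a = eis m n" "b = eis m' n'"
    using assms mem_eisenstein_ring_iff by blast
  then have "a * b = eis (of_int (m * m' - n * n')) (of_int (m * n' + n * m' + n * n'))" by simp
  then show ?thesis using eis_of_int_ring by (simp only:)
qed

lemma eisenstein_ring_add:
  assumes "a \<in> eisenstein_ring" "b \<in> eisenstein_ring"
  shows "a + b \<in> eisenstein_ring"
proof -
  obtain m n m' n' :: int where "a = eis m n" "b = eis m' n'"
    using assms mem_eisenstein_ring_iff by blast
  then have "a + b = eis (of_int (m + m')) (of_int (n + n'))" by simp
  then show ?thesis using eis_of_int_ring by (simp only:)
qed

lemma ideal_J_subset_ring: "ideal_J \<subseteq> eisenstein_ring"
  unfolding mem_eisenstein_ring_iff mem_ideal_J_iff subset_iff by blast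

lemma ideal_J_mult:
  assumes "a \<in> ideal_J" "r \<in> eisenstein_ring" shows "a * r \<in> ideal_J"
proof -
  obtain s where "a = eta6 * s" "s \<in> eisenstein_ring" using assms(1) by (auto simp: ideal_J_def)
  then show ?thesis using eisenstein_ring_mult[of s r] assms(2) by (auto simp: ideal_J_def mult.assoc)
qed

lemma units_ideal_J_iff:
  assumes u: "u \<in> units" and q: "q \<in> eisenstein_ring"
  shows "u * q \<in> ideal_J \<longleftrightarrow> q \<in> ideal_J"
proof -
  have *: "v \<in> eisenstein_ring" if v: "v \<in> units" for v
    using v eis_of_int_ring[of 1 0] eis_of_int_ring[of 0 1] eis_of_int_ring[of "-1" 1]
      eis_of_int_ring[of "-1" 0] eis_of_int_ring[of 0 "-1"] eis_of_int_ring[of 1 "-1"]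
    by (auto simp: units_def)
  have "cnj u \<in> units" using u by (auto simp: units_def)
  then have r: "u \<in> eisenstein_ring" "cnj u \<in> eisenstein_ring" using * u by auto
  have "u * cnj u = 1" using complex_norm_square[of u] units_cmod[OF u] by simp
  moreover have "u * q * cnj u = (u * cnj u) * q" by (simp only: ac_simps)
  ultimately have "u * q * cnj u = q" by simp
  then show ?thesis
    using ideal_J_mult[OF _ r(1), of q] ideal_J_mult[OF _ r(2), of "u * q"]
    by (metis mult.commute)
qed

text \<open>A measure for induction; the floor is exact on Eisenstein integers, whose norms are
  integers.\<close>

definition eis_norm :: "complex \<Rightarrow> nat" where
  "eis_norm q = nat \<lfloor>q \<bullet> q\<rfloor>"

lemma eis_norm_less:
  assumes "p \<in> eisenstein_ring" "q \<in> eisenstein_ring" "cmod p < cmod q"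
  shows "eis_norm p < eis_norm q"
proof -
  have *: "\<exists>N::int. x \<bullet> x = of_int N" if x: "x \<in> eisenstein_ring" for x
  proof -
    obtain m n :: int where "x = eis m n" using x unfolding mem_eisenstein_ring_iff by blast
    then have "x \<bullet> x = of_int (m * m + m * n + n * n)" by (simp add: inner_eis)
    then show ?thesis by blast
  qed
  obtain M N :: int where MN: "p \<bullet> p = of_int M" "q \<bullet> q = of_int N" using * assms by blast
  have "p \<bullet> p < q \<bullet> q"
    using assms(3) by (simp add: inner_self_cmod power_strict_mono)
  moreover have "0 \<le> p \<bullet> p" by simp
  ultimately show ?thesis unfolding eis_norm_def MN by simp
qed

text \<open>A Euclidean descent from \<open>(p, q)\<close> to \<open>(q, p + b * q)\<close>, ended
  by remainder \<open>0\<close>. Adding \<open>b * q\<close> keeps the class of \<open>p\<close>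
  modulo \<open>ideal_J\<close>, so the mixed condition survives the exchange of roles.\<close>

lemma mixed_quotient_in_ratio_set:
  assumes "z0 \<in> generic" "p \<in> eisenstein_ring" "q \<in> eisenstein_ring" "q \<noteq> 0"
    and "p \<in> ideal_J \<longleftrightarrow> q \<notin> ideal_J" "p / q \<in> closed_dual_dom z0"
  shows "p / q \<in> ratio_set z0"
  using assms
proof (induction "eis_norm q" arbitrary: p q z0 rule: less_induct)
  case less
  note z0 = less.prems(1) and p = less.prems(2) and q = less.prems(3,4) and mixed = less.prems(5)
  have shift: "p + b * q \<in> ideal_J \<longleftrightarrow> p \<in> ideal_J" if "b \<in> ideal_J" for b
    using ideal_J_mult[OF that q(1)] ideal_J_add[of p "b * q"] ideal_J_diff[of "p + b * q" "b * q"] by auto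
  obtain b0 where b0: "b0 \<in> ideal_J" "cmod (p / q + b0) < 1 \<or> p / q + b0 \<in> units"
    using covering by blast
  \<comment> \<open>A unit quotient would put numerator and denominator both inside or both outside \<open>ideal_J\<close>.\<close>
  have "p / q + b0 \<notin> units"
  proof
    assume u: "p / q + b0 \<in> units"
    have "(p / q + b0) * q = p + b0 * q" using q by (simp add: field_simps)
    then show False using units_ideal_J_iff[OF u q(1)] shift[OF b0(1)] mixed by simp
  qed
  then obtain b where b: "b \<in> ideal_J" "cmod (p / q + b) < 1" "admissible (z0 + b)"
      "p / q + b \<in> closed_inv_dual_dom (z0 + b)"
    using closed_dual_dom_backward[OF z0 less.prems(6) b0(1)] b0(2) by blast
  show ?case
  proof (cases "p / q + b = 0")
    case True
    then have "p / q = - b" by (simp add: add_eq_0_iff2)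
    then show ?thesis using ratio_set_digit[OF z0 b(1,3)] by simp
  next
    case False
    define p' where "p' = p + b * q"
    have v: "p / q + b = p' / q" using q by (simp add: p'_def field_simps)
    then have p'0: "p' \<noteq> 0" using False by auto
    have p': "p' \<in> eisenstein_ring"
      unfolding p'_def using ideal_J_subset_ring b(1) by (intro eisenstein_ring_add p eisenstein_ring_mult q(1)) auto
    have "cmod p' < cmod q" using b(2) q unfolding v by (simp add: norm_divide)
    then have lt: "eis_norm p' < eis_norm q" using eis_norm_less p' q(1) by blast
    have gen: "1 / (z0 + b) \<in> generic" by (rule generic_inverse_shift[OF z0 b(1,3)])
    have "1 / (p / q + b) \<in> closed_dual_dom (1 / (z0 + b))"
      using closed_inv_dual_dom_inverse[OF b(4) admissible_nonzero[OF b(3)] False] .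
    then have "q / p' \<in> closed_dual_dom (1 / (z0 + b))" unfolding v by simp
    moreover have "q \<in> ideal_J \<longleftrightarrow> p' \<notin> ideal_J"
      unfolding p'_def shift[OF b(1)] using mixed by blast
    ultimately have "q / p' \<in> ratio_set (1 / (z0 + b))"
      by (intro less.hyps[OF lt gen q(1) p' p'0])
    then have "1 / (q / p') - b \<in> ratio_set z0"
      using q p'0 by (intro ratio_set_step[OF z0 b(1,3)]) auto
    moreover have "1 / (q / p') - b = p / q" using v by (simp add: diff_eq_eq)
    ultimately show ?thesis by (simp only:)
  qed
qed

section \<open>Density of the attained ratios\<close>

lemma open_dual_dom: "open (dual_dom z)"
  unfolding dual_dom_def short_vecs_def ball_simps
  by (intro open_Collect_conj open_Collect_imp open_Collect_less closed_Collect_const continuous_intros) simp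

text \<open>By \<open>covering\<close>, \<open>x * q\<close> has a lattice point within distance 1,
  which serves as \<open>p\<close>; dividing by a large \<open>q\<close> makes the error
  small.\<close>

lemma mixed_quotient_dense:
  assumes "0 < d"
  obtains p q where "p \<in> ideal_J" "q \<in> eisenstein_ring" "q \<notin> ideal_J" "dist (p / q) x < d"
proof -
  obtain n :: nat where n: "inverse (of_nat (Suc n)) < d" using reals_Archimedean[OF assms] by blast
  \<comment> \<open>An integer prime to 3 lies outside \<open>ideal_J\<close>.\<close>
  define q where "q = eis (of_int (3 * int n + 1)) (of_int 0)"
  have q: "q \<in> eisenstein_ring" unfolding mem_eisenstein_ring_iff q_def by blast
  have "\<not> (3::int) dvd 3 * int n + 1 - 0" by presburger
  then have qJ: "q \<notin> ideal_J" unfolding mem_ideal_J_iff q_def eis_eq_iff of_int_eq_iff by blast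
  have cq: "cmod q = 3 * real n + 1" unfolding q_def by (simp add: cmod_def)
  then have q0: "q \<noteq> 0" by auto
  obtain b where b: "b \<in> ideal_J" "cmod (x * q + b) < 1 \<or> x * q + b \<in> units" using covering by blast
  then have le: "cmod (x * q + b) \<le> 1" using units_cmod[of "x * q + b"] by auto
  have "- b / q - x = - (x * q + b) / q" using q0 by (simp add: field_simps)
  then have "dist (- b / q) x = cmod (x * q + b) / cmod q"
    by (metis dist_norm norm_divide norm_minus_cancel)
  also have "\<dots> \<le> 1 / cmod q" using le by (intro divide_right_mono) auto
  also have "\<dots> \<le> inverse (of_nat (Suc n))" unfolding cq by (simp add: field_simps)
  also have "\<dots> < d" by (rule n)
  finally have "dist (- b / q) x < d" .
  then show ?thesis using that ideal_J_uminus[OF b(1)] q qJ by blast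
qed

text \<open>As \<open>dual_dom z0\<close> is open, mixed quotients close to one of its points lie in
  it and are attained.\<close>

lemma closure_ratio_set:
  assumes z0: "z0 \<in> generic"
  shows "closure (ratio_set z0) = closure (dual_dom z0)"
proof
  show "closure (ratio_set z0) \<subseteq> closure (dual_dom z0)"
    using ratio_set_subset[OF z0] by (rule closure_mono)
  have "dual_dom z0 \<subseteq> closure (ratio_set z0)"
  proof
    fix x assume "x \<in> dual_dom z0"
    then obtain \<epsilon> where \<epsilon>: "0 < \<epsilon>" "ball x \<epsilon> \<subseteq> dual_dom z0"
      using open_dual_dom open_contains_ball by blast
    show "x \<in> closure (ratio_set z0)"
      unfolding closure_approachable
    proof (intro allI impI)
      fix d :: real assume "0 < d"
      then have "0 < min d \<epsilon>" using \<epsilon> by simp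
      then obtain p q where pq: "p \<in> ideal_J" "q \<in> eisenstein_ring" "q \<notin> ideal_J" "dist (p / q) x < min d \<epsilon>"
        by (rule mixed_quotient_dense)
      then have "p / q \<in> closed_dual_dom z0"
        using \<epsilon> dual_dom_subset_closed by (auto simp: dist_commute subset_iff)
      then have "p / q \<in> ratio_set z0"
        using pq ideal_J_0 ideal_J_subset_ring by (intro mixed_quotient_in_ratio_set[OF z0]) auto
      then show "\<exists>y\<in>ratio_set z0. dist y x < d" using pq(4) by auto
    qed
  qed
  then show "closure (dual_dom z0) \<subseteq> closure (ratio_set z0)"
    by (simp add: closure_minimal)
qed


section \<open>Identification of the cells\<close>

text \<open>Multiply the last two assumptions and cancel \<open>x * y\<close>.\<close>

lemma cyclic_products_less:
  fixes x y z :: real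
  assumes "0 < x" "0 < y" "0 < z" "x\<^sup>2 < y * z" "y\<^sup>2 < x * z"
  shows "x * y < z\<^sup>2"
proof -
  have "x\<^sup>2 * y\<^sup>2 < (y * z) * (x * z)"
    using assms by (intro mult_strict_mono) auto
  then have "(x * y) * (x * y) < (x * y) * z\<^sup>2"
    by (simp add: power2_eq_square ac_simps)
  then show ?thesis using assms by (simp add: mult_less_cancel_left_pos)
qed

lemma cyclic_products_greater:
  fixes x y z :: real
  assumes "0 < x" "0 < y" "0 < z" "y * z < x\<^sup>2" "x * z < y\<^sup>2"
  shows "z\<^sup>2 < x * y"
proof -
  have "(y * z) * (x * z) < x\<^sup>2 * y\<^sup>2"
    using assms by (intro mult_strict_mono) auto
  then have "(x * y) * z\<^sup>2 < (x * y) * (x * y)"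
    by (simp add: power2_eq_square ac_simps)
  then show ?thesis using assms by (simp add: mult_less_cancel_left_pos)
qed

text \<open>The norm form \<open>eis a b \<bullet> eis a b\<close>.\<close>

definition qf :: "real \<Rightarrow> real \<Rightarrow> real" where
  "qf a b = a * a + a * b + b * b"

text \<open>
  In terms of \<open>a\<close>, \<open>b\<close> and \<open>c = 1 - a - b\<close>, the three discs that bound the cells in the
  sector \<open>0 < a, b, c\<close> are \<open>b\<^sup>2 < a c\<close>, \<open>a\<^sup>2 < b c\<close> and \<open>c\<^sup>2 < a b\<close>.
\<close>

lemma qf_products:
  "a - qf a b = a * (1 - a - b) - b\<^sup>2"
  "b - qf a b = b * (1 - a - b) - a\<^sup>2"
  "2 * (a + b) - 1 - qf a b = a * b - (1 - a - b)\<^sup>2"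
  by (simp_all add: qf_def power2_eq_square algebra_simps)

lemma qf_nonneg: "0 \<le> qf a b"
proof -
  have "qf a b = (a + b / 2)\<^sup>2 + 3 / 4 * b\<^sup>2" by (simp add: qf_def power2_eq_square algebra_simps)
  then show ?thesis by simp
qed

context
  fixes a b :: real
  assumes pos: "0 < a" "0 < b" "a + b < 1"
begin

text \<open>The three circles meet at \<open>a = b = c = 1 / 3\<close>. Each claim is a cyclic
  product inequality for a permutation of \<open>a\<close>, \<open>b\<close>,
  \<open>c\<close>.\<close>

lemma two_discs:
  "qf a b < a \<Longrightarrow> qf a b < b \<Longrightarrow> 2 * (a + b) < qf a b + 1"
  "qf a b < a \<Longrightarrow> qf a b + 1 < 2 * (a + b) \<Longrightarrow> b < qf a b"
  "qf a b < b \<Longrightarrow> qf a b + 1 < 2 * (a + b) \<Longrightarrow> a < qf a b"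
  and two_complements:
  "a < qf a b \<Longrightarrow> b < qf a b \<Longrightarrow> qf a b + 1 < 2 * (a + b)"
  "a < qf a b \<Longrightarrow> 2 * (a + b) < qf a b + 1 \<Longrightarrow> qf a b < b"
  "b < qf a b \<Longrightarrow> 2 * (a + b) < qf a b + 1 \<Longrightarrow> qf a b < a"
proof -
  define c where "c = 1 - a - b"
  have pos': "0 < a" "0 < b" "0 < c" using pos by (simp_all add: c_def)
  have iff: "qf a b < a \<longleftrightarrow> b\<^sup>2 < a * c" "a < qf a b \<longleftrightarrow> a * c < b\<^sup>2"
    "qf a b < b \<longleftrightarrow> a\<^sup>2 < b * c" "b < qf a b \<longleftrightarrow> b * c < a\<^sup>2"
    "qf a b + 1 < 2 * (a + b) \<longleftrightarrow> c\<^sup>2 < a * b" "2 * (a + b) < qf a b + 1 \<longleftrightarrow> a * b < c\<^sup>2"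
    using qf_products[where a = a and b = b, folded c_def] by linarith+
  note less = cyclic_products_less[OF pos'(1,2,3)] cyclic_products_less[OF pos'(2,3,1)]
    cyclic_products_less[OF pos'(1,3,2)]
  note greater = cyclic_products_greater[OF pos'(1,2,3)] cyclic_products_greater[OF pos'(2,3,1)]
    cyclic_products_greater[OF pos'(1,3,2)]
  show "qf a b < a \<Longrightarrow> qf a b < b \<Longrightarrow> 2 * (a + b) < qf a b + 1"
    "qf a b < a \<Longrightarrow> qf a b + 1 < 2 * (a + b) \<Longrightarrow> b < qf a b"
    "qf a b < b \<Longrightarrow> qf a b + 1 < 2 * (a + b) \<Longrightarrow> a < qf a b"
    unfolding iff using less by (simp_all add: mult.commute)
  show "a < qf a b \<Longrightarrow> b < qf a b \<Longrightarrow> qf a b + 1 < 2 * (a + b)"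
    "a < qf a b \<Longrightarrow> 2 * (a + b) < qf a b + 1 \<Longrightarrow> qf a b < b"
    "b < qf a b \<Longrightarrow> 2 * (a + b) < qf a b + 1 \<Longrightarrow> qf a b < a"
    unfolding iff using greater by (simp_all add: mult.commute)
qed

text \<open>The conditions that are constant on the sector: inside the small disc of
  \<open>eta6\<close>, outside the large discs of \<open>cnj eta6\<close> and
  \<open>\<i> * sqrt 3\<close>.\<close>

lemma sector_inequalities:
  "qf a b < a + b" "2 * a < qf a b + 1" "2 * b < qf a b + 1" "0 < qf a b"
proof -
  have ab: "0 < a * b" using pos by simp
  have "(a + b) * (a + b) < 1 * (a + b)" using pos by (intro mult_strict_right_mono) auto
  then show "qf a b < a + b" using ab by (simp add: qf_def algebra_simps)
  have "0 < (1 - a)\<^sup>2" "0 < (1 - b)\<^sup>2" using pos by simp_all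
  moreover have "qf a b + 1 - 2 * a = (1 - a)\<^sup>2 + a * b + b * b" "qf a b + 1 - 2 * b = (1 - b)\<^sup>2 + a * b + a * a"
    by (simp_all add: qf_def power2_eq_square algebra_simps)
  moreover have "0 < a * a" "0 < b * b" using pos by simp_all
  ultimately show "2 * a < qf a b + 1" "2 * b < qf a b + 1" "0 < qf a b"
    using ab by (linarith, linarith, simp add: qf_def)
qed

lemma sector_generic:
  assumes "qf a b \<noteq> a" "qf a b \<noteq> b" "qf a b + 1 \<noteq> 2 * (a + b)"
  shows "eis a b \<in> generic"
proof -
  have i: "eis a b \<bullet> eis a b = qf a b" by (simp add: inner_eis qf_def)
  have "eis a b \<in> hexagon" using pos by (simp add: eis_hexagon_iff)
  then show ?thesis
    using pos assms sector_inequalities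
    unfolding generic_def short_vecs_def mem_Collect_eq i ball_simps by (simp add: inner_eis field_simps)
qed

text \<open>Of the twelve conditions in \<open>dual_dom\<close>, eight are void on the sector, one
  always applies and three depend on the point.\<close>

lemma sector_dual_dom:
  "dual_dom (eis a b) = {w. 1 < cmod w \<and> 1 / 2 < cmod (w - eta6 / 2)
     \<and> (qf a b < b \<longrightarrow> 1 / 2 < cmod (w - \<i> * sqrt 3 / 2))
     \<and> (qf a b < a \<longrightarrow> 1 / 2 < cmod (w - cnj eta6 / 2))
     \<and> (qf a b + 1 < 2 * (a + b) \<longrightarrow> 1 < cmod (w - eta6))}"
proof -
  have i: "eis a b \<bullet> eis a b = qf a b" by (simp add: inner_eis qf_def)
  have e: "\<i> * sqrt 3 = eis (- 1) 2" "eta6 = eis 1 1" "cnj (eis 1 1) = eis 2 (- 1)"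
    by (simp_all add: complex_eq_iff eta6_def)
  have in_eis: "2 / 3 * (eis a b \<bullet> eis 1 1) = a + b" "2 / 3 * (eis a b \<bullet> eis (- 1) 2) = b"
    "2 / 3 * (eis a b \<bullet> eis (- 2) 1) = - a" "2 / 3 * (eis a b \<bullet> eis (- 1) (- 1)) = - (a + b)"
    "2 / 3 * (eis a b \<bullet> eis 1 (- 2)) = - b" "2 / 3 * (eis a b \<bullet> eis 2 (- 1)) = a"
    "4 / 3 * (eis a b \<bullet> eis 1 1) = 2 * (a + b)" "4 / 3 * (eis a b \<bullet> eis (- 1) 2) = 2 * b"
    "4 / 3 * (eis a b \<bullet> eis (- 2) 1) = - 2 * a" "4 / 3 * (eis a b \<bullet> eis (- 1) (- 1)) = - 2 * (a + b)"
    "4 / 3 * (eis a b \<bullet> eis 1 (- 2)) = - 2 * b" "4 / 3 * (eis a b \<bullet> eis 2 (- 1)) = 2 * a"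
    by (simp_all add: inner_eis field_simps)
  have f: "\<not> qf a b < - a" "\<not> qf a b < - b" "\<not> qf a b < - (a + b)" "\<not> qf a b + 1 < 2 * a" "\<not> qf a b + 1 < 2 * b"
    "\<not> qf a b + 1 < - 2 * a" "\<not> qf a b + 1 < - 2 * b" "\<not> qf a b + 1 < - 2 * (a + b)" "qf a b < a + b"
    using pos sector_inequalities by simp_all
  show ?thesis
    unfolding dual_dom_def short_vecs_def ball_simps i in_eis e
    using f by blast
qed

end

text \<open>The disc about \<open>e / 2\<close> is covered by the unit discs about \<open>0\<close>
  and \<open>e\<close>. This is why \<open>dual_cell_base\<close> omits it at
  \<open>eta6 / 2\<close> for indices 4, 5 and 6.\<close>

lemma dist_half_short:
  assumes "e \<in> short_vecs" "1 < cmod w" "1 < cmod (w - e)"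
  shows "1 / 2 < cmod (w - e / 2)"
proof -
  have "1 < w \<bullet> w" using assms(2) by (simp add: less_cmod_iff)
  then show ?thesis
    using assms(3) unfolding cmod_diff_short[OF assms(1)] cmod_diff_half_short[OF assms(1)] by linarith
qed

lemma cmod_disc_iff:
  "cmod (eis a b - cnj eta6 / 3) < sqrt 3 / 3 \<longleftrightarrow> qf a b < a"
  "cmod (eis a b - \<i> * sqrt 3 / 3) < sqrt 3 / 3 \<longleftrightarrow> qf a b < b"
  "cmod (eis a b - 2 / 3 * eta6) < sqrt 3 / 3 \<longleftrightarrow> qf a b + 1 < 2 * (a + b)"
  "sqrt 3 / 3 < cmod (eis a b - cnj eta6 / 3) \<longleftrightarrow> a < qf a b"
  "sqrt 3 / 3 < cmod (eis a b - \<i> * sqrt 3 / 3) \<longleftrightarrow> b < qf a b"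
  "sqrt 3 / 3 < cmod (eis a b - 2 / 3 * eta6) \<longleftrightarrow> 2 * (a + b) < qf a b + 1"
proof -
  have e: "eis a b - cnj eta6 / 3 = eis (a - 2 / 3) (b + 1 / 3)"
    "eis a b - \<i> * sqrt 3 / 3 = eis (a + 1 / 3) (b - 2 / 3)"
    "eis a b - 2 / 3 * eta6 = eis (a - 2 / 3) (b - 2 / 3)"
    by (simp_all add: complex_eq_iff eta6_def field_simps)
  have n: "eis (a - 2 / 3) (b + 1 / 3) \<bullet> eis (a - 2 / 3) (b + 1 / 3) = qf a b - a + 1 / 3"
    "eis (a + 1 / 3) (b - 2 / 3) \<bullet> eis (a + 1 / 3) (b - 2 / 3) = qf a b - b + 1 / 3"
    "eis (a - 2 / 3) (b - 2 / 3) \<bullet> eis (a - 2 / 3) (b - 2 / 3) = qf a b - 2 * (a + b) + 4 / 3"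
    by (simp_all add: inner_eis qf_def field_simps)
  have r: "0 \<le> sqrt 3 / (3::real)" "(sqrt 3 / 3)\<^sup>2 = 1 / 3" by (simp_all add: power_divide)
  show "cmod (eis a b - cnj eta6 / 3) < sqrt 3 / 3 \<longleftrightarrow> qf a b < a"
    "cmod (eis a b - \<i> * sqrt 3 / 3) < sqrt 3 / 3 \<longleftrightarrow> qf a b < b"
    "cmod (eis a b - 2 / 3 * eta6) < sqrt 3 / 3 \<longleftrightarrow> qf a b + 1 < 2 * (a + b)"
    "sqrt 3 / 3 < cmod (eis a b - cnj eta6 / 3) \<longleftrightarrow> a < qf a b"
    "sqrt 3 / 3 < cmod (eis a b - \<i> * sqrt 3 / 3) \<longleftrightarrow> b < qf a b"
    "sqrt 3 / 3 < cmod (eis a b - 2 / 3 * eta6) \<longleftrightarrow> 2 * (a + b) < qf a b + 1"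
    unfolding e cmod_less_iff[OF r(1)] less_cmod_iff[OF r(1)] r(2) n by linarith+
qed

text \<open>If \<open>a \<le> 0 \<le> a + b\<close>, then \<open>qf a b \<le> b * b < b\<close>.
  This narrows the quadrant in the cells 2 and 6 to the sector.\<close>

lemma first_coordinate_pos:
  assumes "0 < b" "b < 1" "b < qf a b" "0 < a + b / 2"
  shows "0 < a"
proof (rule ccontr)
  assume "\<not> 0 < a"
  then have "a * (a + b) \<le> 0" using assms by (intro mult_nonpos_nonneg) auto
  moreover have "b * b < b" using mult_strict_right_mono[OF assms(2,1)] by simp
  ultimately show False using assms(3) by (simp add: qf_def algebra_simps)
qed

text \<open>The circle about \<open>2 / 3 * eta6\<close> touches the lines \<open>b = 0\<close> and
  \<open>a = 0\<close> at \<open>1\<close> and \<open>zeta6\<close>. This places the cells 4 and 5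
  in the sector.\<close>

lemma big_disc_coordinates_pos:
  assumes "\<bar>a\<bar> < 1" "\<bar>b\<bar> < 1" "qf a b + 1 < 2 * (a + b)"
  shows "0 < a" "0 < b"
proof -
  have *: "0 < y" if h: "\<bar>x\<bar> < 1" "qf x y + 1 < 2 * (x + y)" for x y :: real
  proof (rule ccontr)
    assume "\<not> 0 < y"
    then have "0 \<le> (2 - x) * (- y)" using h by (intro mult_nonneg_nonneg) auto
    moreover have "qf x y + 1 - 2 * (x + y) = (x - 1)\<^sup>2 + (2 - x) * (- y) + y\<^sup>2"
      by (simp add: qf_def power2_eq_square algebra_simps)
    ultimately show False using h(2) zero_le_power2[of "x - 1"] zero_le_power2[of y] by linarith
  qed
  show "0 < b" using *[OF assms(1,3)] .
  have "qf b a = qf a b" by (simp add: qf_def)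
  then show "0 < a" using *[of b a] assms by (simp add: add.commute)
qed

text \<open>Each cell prescribes the position relative to two of the three discs; the third position
  follows, and together they determine the dual cell.\<close>

lemma cell_base_dual_dom:
  assumes k: "1 \<le> k" "k \<le> 6" and y: "y \<in> cell_base k" "y \<in> hexagon"
  shows "y \<in> generic" "dual_cell_base k = dual_dom y"
proof -
  obtain a b where ab: "y = eis a b" by (rule ex_eis)
  have h: "\<bar>a\<bar> < 1" "\<bar>b\<bar> < 1" "\<bar>a + b\<bar> < 1" using y(2) by (simp_all add: ab eis_hexagon_iff)
  have q0: "0 \<le> qf a b" by (rule qf_nonneg)
  have im: "0 < sqrt 3 * b / 2 \<longleftrightarrow> 0 < b" by (simp add: zero_less_mult_iff)
  have "sqrt 3 * b / 2 < sqrt 3 * (a + b / 2) \<longleftrightarrow> 0 < a"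
    by (simp add: distrib_left zero_less_mult_iff)
  note conds = cmod_disc_iff[of a b] Re_eis Im_eis im this
  have eta: "eta6 \<in> short_vecs" by (simp add: eta6_eis short_vecs_def)
  note half = dist_half_short[OF eta]
  have "k \<in> {1, 2, 3, 4, 5, 6}" using k by auto
  then have "y \<in> generic \<and> dual_cell_base k = dual_dom y"
  proof (elim insertE emptyE)
    assume k: "k = 1"
    have c: "qf a b < a" "qf a b < b"
      using y(1) unfolding cell_base_def k Let_def ab
      by (simp_all add: conds del: less_divide_eq_numeral1 divide_less_eq_numeral1 times_divide_eq_left)
    then have p: "0 < a" "0 < b" "a + b < 1" using h q0 by linarith+
    note t = two_discs(1)[OF p c]
    show ?thesis
      unfolding ab sector_dual_dom[OF p] dual_cell_base_def k
      using sector_generic[OF p] c t by auto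
  next
    assume k: "k = 2"
    have c: "b < qf a b" "2 * (a + b) < qf a b + 1" and p': "0 < a + b / 2" "0 < b"
      using y(1) unfolding cell_base_def k Let_def ab
      by (simp_all add: conds del: less_divide_eq_numeral1 divide_less_eq_numeral1 times_divide_eq_left)
    have p: "0 < a" "0 < b" "a + b < 1"
      using first_coordinate_pos[of b a] h c p' by simp_all
    note t = two_complements(3)[OF p c]
    show ?thesis
      unfolding ab sector_dual_dom[OF p] dual_cell_base_def k
      using sector_generic[OF p] c t by auto
  next
    assume k: "k = 3"
    have c: "a < qf a b" "2 * (a + b) < qf a b + 1" and p': "0 < a" "0 < b"
      using y(1) unfolding cell_base_def k Let_def ab
      by (simp_all add: conds del: less_divide_eq_numeral1 divide_less_eq_numeral1 times_divide_eq_left)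
    have p: "0 < a" "0 < b" "a + b < 1"
      using h p' by simp_all
    note t = two_complements(2)[OF p c]
    show ?thesis
      unfolding ab sector_dual_dom[OF p] dual_cell_base_def k
      using sector_generic[OF p] c t by auto
  next
    assume k: "k = 4"
    have c: "qf a b < a" "qf a b + 1 < 2 * (a + b)"
      using y(1) unfolding cell_base_def k Let_def ab
      by (simp_all add: conds del: less_divide_eq_numeral1 divide_less_eq_numeral1 times_divide_eq_left)
    have p: "0 < a" "0 < b" "a + b < 1"
      using big_disc_coordinates_pos[OF h(1,2) c(2)] h by simp_all
    note t = two_discs(2)[OF p c]
    show ?thesis
      unfolding ab sector_dual_dom[OF p] dual_cell_base_def k
      using sector_generic[OF p] c t half by auto
  next
    assume k: "k = 5"
    have c: "qf a b < b" "qf a b + 1 < 2 * (a + b)"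
      using y(1) unfolding cell_base_def k Let_def ab
      by (simp_all add: conds del: less_divide_eq_numeral1 divide_less_eq_numeral1 times_divide_eq_left)
    have p: "0 < a" "0 < b" "a + b < 1"
      using big_disc_coordinates_pos[OF h(1,2) c(2)] h by simp_all
    note t = two_discs(3)[OF p c]
    show ?thesis
      unfolding ab sector_dual_dom[OF p] dual_cell_base_def k
      using sector_generic[OF p] c t half by auto
  next
    assume k: "k = 6"
    have c: "a < qf a b" "b < qf a b" and p': "0 < a + b / 2" "0 < b"
      using y(1) unfolding cell_base_def k Let_def ab
      by (simp_all add: conds del: less_divide_eq_numeral1 divide_less_eq_numeral1 times_divide_eq_left)
    have p: "0 < a" "0 < b" "a + b < 1"
      using first_coordinate_pos[of b a] h c p' by simp_all
    note t = two_complements(1)[OF p c]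
    show ?thesis
      unfolding ab sector_dual_dom[OF p] dual_cell_base_def k
      using sector_generic[OF p] c t half by auto
  qed
  then show "y \<in> generic" "dual_cell_base k = dual_dom y" by blast+
qed

section \<open>Rotations by sixth roots of unity\<close>

definition hex_rotation :: "complex \<Rightarrow> bool" where
  "hex_rotation c \<longleftrightarrow> cmod c = 1 \<and> (*) c ` short_vecs = short_vecs"

lemma hex_rotation_zeta6_power: "hex_rotation (zeta6 ^ n)"
proof (induction n)
  case 0
  then show ?case by (simp add: hex_rotation_def image_def)
next
  case (Suc n)
  have z: "cmod zeta6 = 1" by (simp add: zeta6_def cmod_def power_divide)
  have "cnj zeta6 * zeta6 = 1" using complex_norm_square[of zeta6] z by (simp add: mult.commute)
  moreover have "zeta6 * (cnj zeta6 * e) = (cnj zeta6 * zeta6) * e" for e by (simp only: ac_simps)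
  ultimately have inv: "zeta6 * (cnj zeta6 * e) = e" for e by simp
  have "(*) zeta6 ` short_vecs = short_vecs"
  proof (intro equalityI subsetI)
    fix e assume "e \<in> short_vecs"
    then show "e \<in> (*) zeta6 ` short_vecs"
      by (intro image_eqI[of _ _ "cnj zeta6 * e"] inv[symmetric] short_cnj_zeta6)
  qed (use short_zeta6 in auto)
  moreover have "(*) (zeta6 ^ Suc n) ` short_vecs = (*) zeta6 ` ((*) (zeta6 ^ n) ` short_vecs)"
    by (simp add: image_image mult.assoc)
  ultimately show ?case using Suc z by (simp add: hex_rotation_def norm_mult)
qed

context
  fixes c :: complex
  assumes c: "hex_rotation c"
begin

lemma rotation_inner: "(c * x) \<bullet> (c * y) = x \<bullet> y"
proof -
  have "(c * x) \<bullet> (c * y) = ((Re c)\<^sup>2 + (Im c)\<^sup>2) * (x \<bullet> y)"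
    by (simp add: inner_complex_def power2_eq_square algebra_simps)
  also have "(Re c)\<^sup>2 + (Im c)\<^sup>2 = 1"
    using c by (simp add: hex_rotation_def cmod_power2[symmetric])
  finally show ?thesis by simp
qed

lemma rotation_ball_short: "(\<forall>e\<in>short_vecs. P e) \<longleftrightarrow> (\<forall>e\<in>short_vecs. P (c * e))"
proof -
  have eq: "(*) c ` short_vecs = short_vecs" using c by (simp add: hex_rotation_def)
  have "(\<forall>e\<in>(*) c ` short_vecs. P e) \<longleftrightarrow> (\<forall>e\<in>short_vecs. P (c * e))" by blast
  then show ?thesis unfolding eq .
qed

lemma rotation_hexagon: "c * z \<in> hexagon \<longleftrightarrow> z \<in> hexagon"
  unfolding hexagon_def mem_Collect_eq
  by (subst rotation_ball_short) (simp only: rotation_inner)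

lemma rotation_closed_hexagon: "c * z \<in> closed_hexagon \<longleftrightarrow> z \<in> closed_hexagon"
  unfolding closed_hexagon_def mem_Collect_eq
  by (subst rotation_ball_short) (simp only: rotation_inner)

lemma rotation_generic: "c * z \<in> generic \<longleftrightarrow> z \<in> generic"
  unfolding generic_def mem_Collect_eq rotation_hexagon
  by (subst rotation_ball_short) (simp only: rotation_inner)

lemma rotation_dual_dom: "dual_dom (c * z) = (*) c ` dual_dom z"
proof -
  have c0: "cmod c = 1" "c \<noteq> 0" using c by (auto simp: hex_rotation_def)
  have "c * w - c * e = c * (w - e)" "c * w - c * e / 2 = c * (w - e / 2)" for w e
    by (simp_all add: algebra_simps)
  then have n: "cmod (c * w) = cmod w" "cmod (c * w - c * e) = cmod (w - e)"
    "cmod (c * w - c * e / 2) = cmod (w - e / 2)" for w e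
    using c0(1) by (simp_all add: norm_mult)
  have iff: "c * w \<in> dual_dom (c * z) \<longleftrightarrow> w \<in> dual_dom z" for w
    unfolding dual_dom_def mem_Collect_eq
    by (subst rotation_ball_short) (simp only: rotation_inner n)
  show ?thesis
  proof (intro set_eqI iffI)
    fix w assume "w \<in> dual_dom (c * z)"
    moreover have "w = c * (w / c)" using c0 by simp
    ultimately show "w \<in> (*) c ` dual_dom z" using iff by (metis image_eqI)
  qed (use iff in auto)
qed

end

text \<open>Cells lie in the closed hexagon, so their interior points lie in the open one; rotating
  back reduces to the base cells.\<close>

lemma interior_cell_dual_dom:
  assumes k: "1 \<le> k" "k \<le> 6" and z0: "z0 \<in> interior (cell k l)"
  shows "z0 \<in> generic" "dual_cell k l = dual_dom z0"
proof -
  define c where "c = zeta6 ^ (l - 1)"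
  have c: "hex_rotation c" unfolding c_def by (rule hex_rotation_zeta6_power)
  have "cell_base k \<subseteq> dom_U" by (auto simp: cell_base_def Let_def)
  then have "cell k l \<subseteq> closed_hexagon"
    using dom_U_subset_closed_hexagon rotation_closed_hexagon[OF c] by (auto simp: cell_def c_def)
  then have "z0 \<in> hexagon" using interior_mono z0 interior_closed_hexagon by blast
  moreover have "z0 \<in> cell k l" using z0 interior_subset by blast
  then obtain y where y: "y \<in> cell_base k" "z0 = c * y" by (auto simp: cell_def c_def)
  ultimately have "y \<in> hexagon" using rotation_hexagon[OF c] by simp
  note base = cell_base_dual_dom[OF k y(1) this]
  show "z0 \<in> generic" using base(1) rotation_generic[OF c] y(2) by simp
  show "dual_cell k l = dual_dom z0"
    unfolding dual_cell_def c_def[symmetric] using rotation_dual_dom[OF c, of y] base(2) y(2) by simp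
qed

theorem proposition2:
  fixes k l :: nat and z0 :: complex
  assumes "1 \<le> k" "k \<le> 6" "1 \<le> l" "l \<le> 6"
    and "z0 \<in> interior (cell k l)"
  shows "closure {- (cf_denom n z / cf_denom (n - 1) z) | n z.
            n \<ge> 1 \<and> z \<in> dom_U \<and> (cf_map ^^ n) z = z0}
         = closure (dual_cell k l)"
  using closure_ratio_set[OF interior_cell_dual_dom(1)[OF assms(1,2,5)]]
    interior_cell_dual_dom(2)[OF assms(1,2,5)]
  by (simp add: ratio_set_def)

end
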